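(* Let $\theta,\gamma,\nu>0$ satisfy $$4\nu\theta(1+\gamma)^2=\gamma,\qquad 1+2\gamma+\frac{2\gamma\theta^2}{(1+\theta)^2}\le\frac{\theta}{1+\theta}+\frac{\theta^2}{(1+\theta)^2}.$$ There exists a constant $C>0$ depending only on $\theta,\gamma,\nu$ such that the following holds. Let $f:\mathbb{R}^d\to\mathbb{R}$ be convex and $(L_0,L_1)$-smooth for some $L_0,L_1>0$, let $x^*$ be a minimizer of $f$, let $x_0\in\mathbb{R}^d$, $\epsilon>0$, and let $\eta_0>0$ satisfy $\eta_0L_0\exp(L_1\|x_0-x^*\|)\le1$. Define $\mathcal{D}\ge0$ by $$\mathcal{D}^2=\max\left\{\tfrac{1}{\gamma\theta},\,2(1+\gamma),\,(1+2\theta)^2\right\}\left(\|x_0-x^*\|^2+(1+\gamma\theta)\eta_0^2\|\nabla f(x_0)\|^2\right).$$ Then $\mathcal{D}\le C\|x_0-x^*\|$, and for every integer $K\ge1$ with $$K\ge C\left(1+\sqrt{\frac{L_0\mathcal{D}^2}{\epsilon}}+L_1^3\mathcal{D}^3+\left(1+L_1^2\mathcal{D}^2\right)\ln\frac{1}{\eta_0L_0}\right),$$ the output $\overline{x}_K$ of Accelerated GRAAL (defined in the context), run for $K$ iterations with parameters $\theta,\gamma,\nu$, starting point $x_0$ and initial stepsize $\eta_0$, satisfies $f(\overline{x}_K)-f(x^* )\le\epsilon$.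
   Context: $\mathbb{R}^d$ is a finite-dimensional Euclidean space with inner product $\langle\cdot,\cdot\rangle$ and norm $\|\cdot\|$. A function $f$ is $(L_0,L_1)$-smooth if it is twice continuously differentiable and $\|\nabla^2f(x)\|\le L_0+L_1\|\nabla f(x)\|$ for all $x\in\mathbb{R}^d$ (operator norm on the left). The Bregman divergence of $f$ is $D_f(x;z)=f(x)-f(z)-\langle\nabla f(z),x-z\rangle$. The curvature estimator is $\Lambda(x;z)=\frac{2D_f(x;z)}{\|\nabla f(x)-\nabla f(z)\|^2}$ if $\nabla f(x)\ne\nabla f(z)$ and $\Lambda(x;z)=+\infty$ if $\nabla f(x)=\nabla f(z)$. Accelerated GRAAL with parameters $\theta,\gamma,\nu$, starting point $x_0$, initial stepsize $\eta_0>0$ and number of iterations $K$: set $\alpha_0=\beta_0=1$, $H_0=H_{-1}=\eta_{-1}=\eta_0$, $\tilde{x}_0=\overline{x}_0=x_0$. For $k=0,1,\dots,K-1$ compute, in this order: $\alpha_{k+1}=\frac{(1+\gamma)\eta_k}{H_k+(1+\gamma)\eta_k}$; $x_{k+1}=x_k-\eta_k\nabla f(\tilde{x}_k)$; $\overline{x}_{k+1}=\beta_k\tilde{x}_k+(1-\beta_k)\overline{x}_k$; $\hat{x}_{k+1}=x_{k+1}+\theta(x_{k+1}-x_k)$; $\tilde{x}_{k+1}=\alpha_{k+1}\hat{x}_{k+1}+(1-\alpha_{k+1})\overline{x}_{k+1}$; $\lambda_{k+1}=\min\{\Lambda(\overline{x}_{k+1};\tilde{x}_k),\Lambda(\overline{x}_{k+1};\tilde{x}_{k+1})\}$;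 $\eta_{k+1}=\min\{(1+\gamma)\eta_k,\ \nu H_{k-1}\lambda_{k+1}/\eta_{k-1}\}$; $H_{k+1}=H_k+\eta_{k+1}$; $\beta_{k+1}=\frac{\eta_{k+1}}{\alpha_{k+1}H_{k+1}}$. The output is $\overline{x}_K$. Convention: if $\lambda_{k+1}=+\infty$ then $\nu H_{k-1}\lambda_{k+1}/\eta_{k-1}=+\infty$ (so $\eta_{k+1}=(1+\gamma)\eta_k$). *)

theory Defs
  imports "HOL-Analysis.Analysis"
begin

(* The constant of the theorem must not depend on the dimension d, so d cannot be a type.
   All spaces R^d are realised inside one real inner product space: the finitely supported
   real sequences.  R^d is the subspace of sequences supported on the first d coordinates. *)

typedef fseq = "{x :: nat \<Rightarrow> real. finite {i. x i \<noteq> 0}}"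
  morphisms coord Abs_fseq
  by (rule exI [of _ "\<lambda>_. 0"]) simp

setup_lifting type_definition_fseq

lemma finite_coord [simp]: "finite {i. coord x i \<noteq> 0}"
  using coord [of x] by simp

lemma fseq_eqI: "(\<And>i. coord x i = coord y i) \<Longrightarrow> x = y"
  by (metis coord_inject ext)

instantiation fseq :: real_vector
begin

lift_definition zero_fseq :: fseq is "\<lambda>_. 0"
  by simp

lift_definition plus_fseq :: "fseq \<Rightarrow> fseq \<Rightarrow> fseq" is "\<lambda>x y i. x i + y i"
  subgoal for x y
    by (rule finite_subset [of _ "{i. x i \<noteq> 0} \<union> {i. y i \<noteq> 0}"]) auto
  done

lift_definition minus_fseq :: "fseq \<Rightarrow> fseq \<Rightarrow> fseq" is "\<lambda>x y i. x i - y i"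
  subgoal for x y
    by (rule finite_subset [of _ "{i. x i \<noteq> 0} \<union> {i. y i \<noteq> 0}"]) auto
  done

lift_definition uminus_fseq :: "fseq \<Rightarrow> fseq" is "\<lambda>x i. - x i"
  by simp

lift_definition scaleR_fseq :: "real \<Rightarrow> fseq \<Rightarrow> fseq" is "\<lambda>r x i. r * x i"
  subgoal for r x
    by (rule finite_subset [of _ "{i. x i \<noteq> 0}"]) auto
  done

instance
  by standard (transfer; auto simp: algebra_simps)+

end

lemma coord_simps [simp]:
  "coord 0 i = 0"
  "coord (x + y) i = coord x i + coord y i"
  "coord (x - y) i = coord x i - coord y i"
  "coord (- x) i = - coord x i"
  "coord (r *\<^sub>R x) i = r * coord x i"
  by (transfer; simp)+

instantiation fseq :: real_inner
begin

definition inner_fseq :: "fseq \<Rightarrow> fseq \<Rightarrow> real" where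
  "inner_fseq x y = (\<Sum>i | coord x i \<noteq> 0. coord x i * coord y i)"

definition norm_fseq :: "fseq \<Rightarrow> real" where
  "norm_fseq x = sqrt (inner x x)"

definition sgn_fseq :: "fseq \<Rightarrow> fseq" where
  "sgn_fseq x = x /\<^sub>R norm x"

definition dist_fseq :: "fseq \<Rightarrow> fseq \<Rightarrow> real" where
  "dist_fseq x y = norm (x - y)"

definition uniformity_fseq :: "(fseq \<times> fseq) filter" where
  "uniformity_fseq = (INF e\<in>{0 <..}. principal {(x, y). dist x y < e})"

definition open_fseq :: "fseq set \<Rightarrow> bool" where
  "open_fseq U \<longleftrightarrow> (\<forall>x\<in>U. eventually (\<lambda>(x', y). x' = x \<longrightarrow> y \<in> U) uniformity)"

lemma inner_fseq_superset:
  assumes "finite A" "{i. coord x i \<noteq> 0} \<subseteq> A"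
  shows "inner x y = (\<Sum>i\<in>A. coord x i * coord y i)"
  unfolding inner_fseq_def by (rule sum.mono_neutral_left) (use assms in auto)

instance
proof
  fix x y z :: fseq and r :: real
  let ?A = "{i. coord x i \<noteq> 0} \<union> {i. coord y i \<noteq> 0}"
  have A: "finite ?A" by simp
  show "inner x y = inner y x"
    using inner_fseq_superset [OF A, of x y] inner_fseq_superset [OF A, of y x]
    by (simp add: mult.commute)
  have "{i. coord (x + y) i \<noteq> 0} \<subseteq> ?A" by auto
  then show "inner (x + y) z = inner x z + inner y z"
    using inner_fseq_superset [OF A, of "x + y" z] inner_fseq_superset [OF A, of x z]
      inner_fseq_superset [OF A, of y z]
    by (simp add: sum.distrib distrib_right)
  have "{i. coord (r *\<^sub>R x) i \<noteq> 0} \<subseteq> {i. coord x i \<noteq> 0}" by auto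
  then show "inner (r *\<^sub>R x) y = r * inner x y"
    using inner_fseq_superset [OF finite_coord, of "r *\<^sub>R x" x y]
      inner_fseq_superset [OF finite_coord, of x x y]
    by (simp add: sum_distrib_left mult.assoc)
  show "0 \<le> inner x x"
    unfolding inner_fseq_def by (rule sum_nonneg) simp
  show "(inner x x = 0) = (x = 0)"
  proof
    assume "inner x x = 0"
    then have "\<forall>i\<in>{i. coord x i \<noteq> 0}. coord x i * coord x i = 0"
      unfolding inner_fseq_def by (subst (asm) sum_nonneg_eq_0_iff) auto
    then show "x = 0" by (intro fseq_eqI) auto
  qed (simp add: inner_fseq_def)
qed (simp_all add: norm_fseq_def sgn_fseq_def dist_fseq_def uniformity_fseq_def open_fseq_def)

end

definition Rd :: "nat \<Rightarrow> fseq set" where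
  "Rd d = {x. \<forall>i\<ge>d. coord x i = 0}"

lemma subspace_Rd: "subspace (Rd d)"
  by (auto simp: subspace_def Rd_def)

lemma inner_Rd:
  assumes "x \<in> Rd d"
  shows "inner x y = (\<Sum>i<d. coord x i * coord y i)"
  by (rule inner_fseq_superset) (use assms in \<open>auto simp: Rd_def not_le [symmetric]\<close>)

(* Every vector of d reals is the coordinate vector of a point of R^d. *)
lemma Rd_surj: "\<exists>x\<in>Rd d. \<forall>i<d. coord x i = v i"
proof -
  have "finite {i. (if i < d then v i else 0) \<noteq> 0}"
    by (rule finite_subset [of _ "{..<d}"]) auto
  then have "coord (Abs_fseq (\<lambda>i. if i < d then v i else 0)) = (\<lambda>i. if i < d then v i else 0)"
    by (simp add: Abs_fseq_inverse)
  then show ?thesis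
    by (intro bexI [of _ "Abs_fseq (\<lambda>i. if i < d then v i else 0)"]) (auto simp: Rd_def)
qed

(* A function on R^d is a function on fseq of which only the values on Rd d are used:
   all derivatives are taken within Rd d. *)

definition grad :: "nat \<Rightarrow> (fseq \<Rightarrow> real) \<Rightarrow> fseq \<Rightarrow> fseq" where
  "grad d f x = (THE g. g \<in> Rd d \<and> (f has_derivative (\<lambda>h. inner g h)) (at x within Rd d))"

lemma has_derivative_Rd_unique:
  fixes F :: "fseq \<Rightarrow> 'b::real_normed_vector"
  assumes A: "(F has_derivative A) (at x within Rd d)"
    and B: "(F has_derivative B) (at x within Rd d)"
    and x: "x \<in> Rd d" and v: "v \<in> Rd d"
  shows "A v = B v"
proof -
  have line: "((\<lambda>t. x + t *\<^sub>R v) has_derivative (\<lambda>t. t *\<^sub>R v)) (at (0::real))"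
    by (auto intro!: derivative_eq_intros)
  have sub: "(\<lambda>t. x + t *\<^sub>R v) ` UNIV \<subseteq> Rd d"
    using x v by (auto intro!: subspace_add [OF subspace_Rd] subspace_scale [OF subspace_Rd])
  have "((\<lambda>t. F (x + t *\<^sub>R v)) has_derivative (\<lambda>t. A' (t *\<^sub>R v))) (at 0)"
    if "(F has_derivative A') (at x within Rd d)" for A'
    by (rule has_derivative_in_compose [OF line]) (use has_derivative_subset [OF that sub] in simp)
  from has_derivative_unique [OF this [OF A] this [OF B]]
  have "(\<lambda>t. A (t *\<^sub>R v)) = (\<lambda>t. B (t *\<^sub>R v))" .
  then show ?thesis by (metis scaleR_one)
qed

lemma grad_eqI:
  assumes "x \<in> Rd d" "g \<in> Rd d" "(f has_derivative (\<lambda>h. inner g h)) (at x within Rd d)"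
  shows "grad d f x = g"
  unfolding grad_def
proof (rule the_equality)
  fix g' assume g': "g' \<in> Rd d \<and> (f has_derivative (\<lambda>h. inner g' h)) (at x within Rd d)"
  have "g' - g \<in> Rd d"
    using g' assms(2) by (auto intro: subspace_diff [OF subspace_Rd])
  then have "inner g' (g' - g) = inner g (g' - g)"
    using has_derivative_Rd_unique g' assms by blast
  then have "inner (g' - g) (g' - g) = 0"
    by (simp add: inner_diff_left)
  then show "g' = g" by simp
qed (use assms in blast)

lemma grad_works:
  assumes x: "x \<in> Rd d" and f: "f differentiable (at x within Rd d)"
  shows "grad d f x \<in> Rd d"
    and "(f has_derivative (\<lambda>h. inner (grad d f x) h)) (at x within Rd d)"
proof -
  obtain f' where f': "(f has_derivative f') (at x within Rd d)"
    using f by (auto simp: differentiable_def)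
  then interpret f': bounded_linear f' by (rule has_derivative_bounded_linear)
  define e where "e i = Abs_fseq (\<lambda>j. if j = i then 1 else 0)" for i
  have e: "coord (e i) j = (if j = i then 1 else 0)" for i j
    by (simp add: e_def Abs_fseq_inverse)
  obtain g where g: "g \<in> Rd d" "\<forall>i<d. coord g i = f' (e i)"
    using Rd_surj [of d "\<lambda>i. f' (e i)"] by blast
  have eq: "f' h = inner g h" if h: "h \<in> Rd d" for h
  proof -
    have c: "coord (\<Sum>i\<in>I. k i *\<^sub>R e i) j = (\<Sum>i\<in>I. k i * coord (e i) j)" for I k j
      by (induction I rule: infinite_finite_induct) simp_all
    have "h = (\<Sum>i<d. coord h i *\<^sub>R e i)"
      by (rule fseq_eqI) (use h in \<open>simp add: c e Rd_def not_less if_distrib [of "(*) _"] cong: if_cong\<close>)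
    then have "f' h = f' (\<Sum>i<d. coord h i *\<^sub>R e i)"
      by (rule arg_cong)
    also have "\<dots> = (\<Sum>i<d. coord h i * f' (e i))"
      by (simp add: f'.sum f'.scaleR)
    finally have "f' h = (\<Sum>i<d. coord h i * f' (e i))" .
    then show ?thesis using g by (simp add: inner_Rd mult.commute)
  qed
  have "(f has_derivative (\<lambda>h. inner g h)) (at x within Rd d)"
    unfolding has_derivative_within
  proof
    show "bounded_linear (\<lambda>h. inner g h)"
      by (rule bounded_linear_inner_right)
    have "((\<lambda>y. (1 / norm (y - x)) *\<^sub>R (f y - (f x + f' (y - x)))) \<longlongrightarrow> 0) (at x within Rd d)"
      using f' unfolding has_derivative_within by simp
    then show "((\<lambda>y. (1 / norm (y - x)) *\<^sub>R (f y - (f x + inner g (y - x)))) \<longlongrightarrow> 0) (at x within Rd d)"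
      by (rule Lim_transform_within [OF _ zero_less_one])
        (simp add: eq subspace_diff [OF subspace_Rd] x)
  qed
  with grad_eqI [OF x g(1)] g(1)
  show "grad d f x \<in> Rd d"
    "(f has_derivative (\<lambda>h. inner (grad d f x) h)) (at x within Rd d)"
    by simp_all
qed

(* The derivative of the gradient; by has_derivative_Rd_unique it is determined only on Rd d, and below it is only
   applied to vectors of Rd d. *)
definition hess :: "nat \<Rightarrow> (fseq \<Rightarrow> real) \<Rightarrow> fseq \<Rightarrow> fseq \<Rightarrow> fseq" where
  "hess d f x = frechet_derivative (grad d f) (at x within Rd d)"

(* The library's onorm, relativised to Rd d. *)
definition onorm_Rd :: "nat \<Rightarrow> (fseq \<Rightarrow> fseq) \<Rightarrow> real" where
  "onorm_Rd d A = (SUP v\<in>Rd d. norm (A v) / norm v)"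

definition twice_cont_diff :: "nat \<Rightarrow> (fseq \<Rightarrow> real) \<Rightarrow> bool" where
  "twice_cont_diff d f \<longleftrightarrow>
     f differentiable_on Rd d \<and>
     grad d f differentiable_on Rd d \<and>
     (\<forall>x\<in>Rd d. ((\<lambda>y. onorm_Rd d (\<lambda>v. hess d f y v - hess d f x v)) \<longlongrightarrow> 0) (at x within Rd d))"

definition L0L1_smooth :: "nat \<Rightarrow> real \<Rightarrow> real \<Rightarrow> (fseq \<Rightarrow> real) \<Rightarrow> bool" where
  "L0L1_smooth d L0 L1 f \<longleftrightarrow>
     twice_cont_diff d f \<and>
     (\<forall>x\<in>Rd d. onorm_Rd d (hess d f x) \<le> L0 + L1 * norm (grad d f x))"

definition minimizer :: "nat \<Rightarrow> (fseq \<Rightarrow> real) \<Rightarrow> fseq \<Rightarrow> bool" where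
  "minimizer d f z \<longleftrightarrow> z \<in> Rd d \<and> (\<forall>y\<in>Rd d. f z \<le> f y)"

definition bregman :: "nat \<Rightarrow> (fseq \<Rightarrow> real) \<Rightarrow> fseq \<Rightarrow> fseq \<Rightarrow> real" where
  "bregman d f x z = f x - f z - inner (grad d f z) (x - z)"

definition curv :: "nat \<Rightarrow> (fseq \<Rightarrow> real) \<Rightarrow> fseq \<Rightarrow> fseq \<Rightarrow> ereal" where
  "curv d f x z =
     (if grad d f x = grad d f z then \<infinity>
      else ereal (2 * bregman d f x z / (norm (grad d f x - grad d f z))\<^sup>2))"

(* State after k iterations.  eta_prev and H_prev are the values at index k - 1. *)
record graal_state =
  pt :: fseq        (* x_k *)
  pt_bar :: fseq    (* averaged point, x-bar_k *)
  pt_tilde :: fseq  (* gradient evaluation point, x-tilde_k *)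
  alpha :: real
  beta :: real
  eta :: real
  eta_prev :: real
  H :: real
  H_prev :: real

definition graal_init :: "fseq \<Rightarrow> real \<Rightarrow> graal_state" where
  "graal_init x0 eta0 =
     \<lparr>pt = x0, pt_bar = x0, pt_tilde = x0, alpha = 1, beta = 1,
      eta = eta0, eta_prev = eta0, H = eta0, H_prev = eta0\<rparr>"

definition graal_step ::
    "nat \<Rightarrow> (fseq \<Rightarrow> real) \<Rightarrow> real \<Rightarrow> real \<Rightarrow> real \<Rightarrow> graal_state \<Rightarrow> graal_state" where
  "graal_step d f \<theta> \<gamma> \<nu> s =
    (let a = (1 + \<gamma>) * eta s / (H s + (1 + \<gamma>) * eta s);
         x = pt s - eta s *\<^sub>R grad d f (pt_tilde s);
         xbar = beta s *\<^sub>R pt_tilde s + (1 - beta s) *\<^sub>R pt_bar s;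
         xhat = x + \<theta> *\<^sub>R (x - pt s);
         xtilde = a *\<^sub>R xhat + (1 - a) *\<^sub>R xbar;
         lam = min (curv d f xbar (pt_tilde s)) (curv d f xbar xtilde);
         e = (if lam = \<infinity> then (1 + \<gamma>) * eta s
              else min ((1 + \<gamma>) * eta s) (\<nu> * H_prev s * real_of_ereal lam / eta_prev s));
         h = H s + e
     in \<lparr>pt = x, pt_bar = xbar, pt_tilde = xtilde, alpha = a, beta = e / (a * h),
         eta = e, eta_prev = eta s, H = h, H_prev = H s\<rparr>)"

definition graal_output ::
    "nat \<Rightarrow> (fseq \<Rightarrow> real) \<Rightarrow> real \<Rightarrow> real \<Rightarrow> real \<Rightarrow> fseq \<Rightarrow> real \<Rightarrow> nat \<Rightarrow> fseq" where
  "graal_output d f \<theta> \<gamma> \<nu> x0 eta0 K =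
     pt_bar ((graal_step d f \<theta> \<gamma> \<nu> ^^ K) (graal_init x0 eta0))"

end

theory Submission
  imports Defs
begin

text \<open>The Lyapunov function
  \<open>\<parallel>x\<^sub>k\<^sub>+\<^sub>1 - x*\<parallel>\<^sup>2 + \<theta> \<parallel>x\<^sub>k\<^sub>+\<^sub>1 - x\<^sub>k\<parallel>\<^sup>2 + 2 H\<^sub>k (f(xb\<^sub>k\<^sub>+\<^sub>1) - f(x*))\<close> plus a weighted
  Bregman divergence is nonincreasing: the curvature estimator makes the stepsize small enough for
  the divergences gained from convexity to absorb the change of the gradient between two consecutive
  steps.  Hence all iterates stay in a ball of radius \<open>O(R)\<close> with \<open>R = \<parallel>x\<^sub>0 - x*\<parallel>\<close>, and the gap after
  \<open>k + 1\<close> iterations is \<open>O(R\<^sup>2 / H\<^sub>k)\<close>.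

  For the growth of \<open>H\<close> put \<open>q = L1 R\<close>, \<open>A = L0 H\<close>, \<open>a = L0 \<eta>\<close>.  The gradients satisfy
  \<open>L0 + L1 \<parallel>\<nabla>f\<parallel> = O(L0 + q\<^sup>2 / H)\<close> at the averaged points, and by Gronwall they are at most
  \<open>exp (O(q a / A))\<close> times larger at the points where the gradient is evaluated.  So each step multiplies
  \<open>a\<close> by \<open>1 + \<gamma>\<close> or yields a lower bound on it that is poor only after steps with large \<open>a / A\<close>.
  Such steps increase \<open>sqrt A + (1 + q\<^sup>2) ln A\<close> by enough to pay for the subsequent recovery, and
  this potential grows linearly on average.\<close>

section \<open>Convex functions with generalised smoothness\<close>

lemma Rd_closed [simp, intro]:
  "0 \<in> Rd d"
  "x \<in> Rd d \<Longrightarrow> y \<in> Rd d \<Longrightarrow> x + y \<in> Rd d"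
  "x \<in> Rd d \<Longrightarrow> y \<in> Rd d \<Longrightarrow> x - y \<in> Rd d"
  "x \<in> Rd d \<Longrightarrow> c *\<^sub>R x \<in> Rd d"
  by (auto simp: Rd_def)

text \<open>Boundedness of \<open>A\<close> on the whole space bounds the quotients, so the supremum
  in \<open>onorm_Rd\<close> is a genuine upper bound.\<close>

lemma norm_le_onorm_Rd:
  assumes "bounded_linear A" "v \<in> Rd d"
  shows "norm (A v) \<le> onorm_Rd d A * norm v"
proof (cases "v = 0")
  case True
  then show ?thesis
    using linear_simps(3) [OF assms(1)] by simp
next
  case False
  obtain B where B: "\<And>v. norm (A v) \<le> norm v * B"
    using bounded_linear.bounded [OF assms(1)] by blast
  have "norm (A v) / norm v \<le> \<bar>B\<bar>" for v
  proof (cases "v = 0")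
    case False
    have "norm v * B \<le> norm v * \<bar>B\<bar>" by (intro mult_left_mono) auto
    with B [of v] have "norm (A v) \<le> norm v * \<bar>B\<bar>" by linarith
    with False show ?thesis by (simp add: field_simps)
  qed simp
  then have "bdd_above ((\<lambda>v. norm (A v) / norm v) ` Rd d)"
    by (auto intro!: bdd_aboveI)
  then have "norm (A v) / norm v \<le> onorm_Rd d A"
    unfolding onorm_Rd_def by (rule cSUP_upper [OF assms(2)])
  with False show ?thesis by (simp add: field_simps)
qed

locale L0L1_convex =
  fixes d :: nat and f :: "fseq \<Rightarrow> real" and L0 L1 :: real
  assumes conv: "convex_on (Rd d) f"
    and L0: "L0 > 0" and L1: "L1 > 0"
    and smooth: "L0L1_smooth d L0 L1 f"
begin

abbreviation "g \<equiv> grad d f"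

abbreviation "ell x \<equiv> L0 + L1 * norm (g x)"

lemma ell_pos [simp]: "0 < ell x" "0 \<le> ell x"
  using L0 L1 by (auto intro!: add_pos_nonneg add_nonneg_nonneg)

lemma
  assumes "x \<in> Rd d"
  shows g_Rd [simp]: "g x \<in> Rd d"
    and f_deriv: "(f has_derivative (\<lambda>h. inner (g x) h)) (at x within Rd d)"
proof -
  have "f differentiable (at x within Rd d)"
    using smooth assms by (auto simp: L0L1_smooth_def twice_cont_diff_def differentiable_on_def)
  from grad_works [OF assms this] show "g x \<in> Rd d"
    "(f has_derivative (\<lambda>h. inner (g x) h)) (at x within Rd d)" .
qed

lemma g_deriv:
  assumes "x \<in> Rd d"
  shows "(g has_derivative hess d f x) (at x within Rd d)"
  using smooth assms
  by (auto simp: L0L1_smooth_def twice_cont_diff_def differentiable_on_def hess_def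
      frechet_derivative_works [symmetric])

lemma hess_bound:
  assumes x: "x \<in> Rd d" and v: "v \<in> Rd d"
  shows "norm (hess d f x v) \<le> ell x * norm v"
proof -
  have "norm (hess d f x v) \<le> onorm_Rd d (hess d f x) * norm v"
    by (rule norm_le_onorm_Rd [OF has_derivative_bounded_linear [OF g_deriv [OF x]] v])
  also have "\<dots> \<le> ell x * norm v"
    using smooth x by (intro mult_right_mono) (auto simp: L0L1_smooth_def)
  finally show ?thesis .
qed

section \<open>Calculus along lines and growth of the gradient\<close>

lemma has_derivative_along_line:
  fixes F :: "fseq \<Rightarrow> 'b::real_normed_vector"
  assumes F: "(F has_derivative F') (at (x + t *\<^sub>R v) within Rd d)"
    and x: "x \<in> Rd d" and v: "v \<in> Rd d"
  shows "((\<lambda>t. F (x + t *\<^sub>R v)) has_vector_derivative F' v) (at t)"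
proof -
  interpret bounded_linear F' by (rule has_derivative_bounded_linear [OF F])
  have line: "((\<lambda>t. x + t *\<^sub>R v) has_derivative (\<lambda>t. t *\<^sub>R v)) (at t)"
    by (auto intro!: derivative_eq_intros)
  \<comment> \<open>The whole line stays in \<open>Rd d\<close>, so a derivative within
    \<open>Rd d\<close> becomes an unrestricted derivative in the real parameter.\<close>
  have sub: "(\<lambda>t. x + t *\<^sub>R v) ` UNIV \<subseteq> Rd d"
    using x v by auto
  have "((\<lambda>t. F (x + t *\<^sub>R v)) has_derivative (\<lambda>t. F' (t *\<^sub>R v))) (at t)"
    by (rule has_derivative_in_compose [OF line]) (use has_derivative_subset [OF F sub] in simp)
  then show ?thesis by (simp add: has_vector_derivative_def scaleR)
qed

lemma f_line:
  assumes "x \<in> Rd d" "v \<in> Rd d"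
  shows "((\<lambda>t. f (x + t *\<^sub>R v)) has_real_derivative inner (g (x + t *\<^sub>R v)) v) (at t)"
  using has_derivative_along_line [OF f_deriv] assms
  by (simp add: has_real_derivative_iff_has_vector_derivative)

lemma g_line:
  assumes "x \<in> Rd d" "v \<in> Rd d"
  shows "((\<lambda>t. g (x + t *\<^sub>R v)) has_vector_derivative hess d f (x + t *\<^sub>R v) v) (at t)"
  using has_derivative_along_line [OF g_deriv] assms by simp

text \<open>The norm of the gradient is regularised to make it differentiable along the segment.\<close>

lemma ell_growth_reg:
  assumes x: "x \<in> Rd d" and y: "y \<in> Rd d" and e: "e > 0"
  shows "ell y \<le> exp (L1 * norm (y - x)) * (L0 + L1 * sqrt ((norm (g x))\<^sup>2 + e))"
proof -
  define v where "v = y - x"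
  define F where "F t = g (x + t *\<^sub>R v)" for t
  define N where "N t = sqrt (inner (F t) (F t) + e)" for t
  define k where "k = L1 * norm v"
  have v: "v \<in> Rd d" using x y by (simp add: v_def)
  have Npos: "0 < inner (F t) (F t) + e" for t using e by (simp add: add_nonneg_pos)
  have N0: "0 < N t" for t using Npos by (simp add: N_def)
  have FN: "norm (F t) \<le> N t" for t
    unfolding N_def norm_eq_sqrt_inner using e by simp
  have N': "(N has_real_derivative inner (F t) (hess d f (x + t *\<^sub>R v) v) / N t) (at t)" for t
  proof -
    have "((\<lambda>t. inner (F t) (F t) + e) has_real_derivative
        2 * inner (F t) (hess d f (x + t *\<^sub>R v) v)) (at t)"
      using has_derivative_inner [OF g_line [OF x v, unfolded has_vector_derivative_def]
          g_line [OF x v, unfolded has_vector_derivative_def], of t]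
      unfolding has_field_derivative_def F_def
      by (intro has_derivative_eq_rhs [OF has_derivative_add [OF _ has_derivative_const]])
        (auto simp: inner_commute fun_eq_iff algebra_simps)
    from DERIV_chain2 [OF DERIV_real_sqrt [OF Npos] this]
    show ?thesis by (simp add: N_def [abs_def] field_simps)
  qed
  \<comment> \<open>Gronwall's argument: the derivative of \<open>L0 + L1 * N t\<close> is at most
    \<open>k\<close> times this function, so the factor \<open>exp (- k * t)\<close> makes it
    nonincreasing.\<close>
  have "(L0 + L1 * N 1) * exp (- k * 1) \<le> (L0 + L1 * N 0) * exp (- k * 0)"
  proof (rule DERIV_nonpos_imp_nonincreasing [of 0 1 "\<lambda>t. (L0 + L1 * N t) * exp (- k * t)"])
    fix t :: real
    have "inner (F t) (hess d f (x + t *\<^sub>R v) v) \<le> norm (F t) * norm (hess d f (x + t *\<^sub>R v) v)"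
      by (rule norm_cauchy_schwarz)
    also have "\<dots> \<le> N t * ((L0 + L1 * norm (F t)) * norm v)"
      using hess_bound [of "x + t *\<^sub>R v" v] x v FN [of t] N0 [of t]
      by (intro mult_mono) (auto simp: F_def)
    also have "\<dots> \<le> N t * ((L0 + L1 * N t) * norm v)"
      using FN [of t] N0 [of t] L1 by (intro mult_left_mono mult_right_mono add_left_mono) auto
    finally have "inner (F t) (hess d f (x + t *\<^sub>R v) v) / N t \<le> (L0 + L1 * N t) * norm v"
      using N0 [of t] by (simp add: field_simps)
    then have le: "L1 * (inner (F t) (hess d f (x + t *\<^sub>R v) v) / N t) \<le> k * (L0 + L1 * N t)"
      using mult_left_mono [of _ _ L1] L1 by (fastforce simp: k_def mult_ac)
    show "\<exists>y. ((\<lambda>t. (L0 + L1 * N t) * exp (- k * t)) has_real_derivative y) (at t) \<and> y \<le> 0"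
    proof (intro exI conjI)
      show "((\<lambda>t. (L0 + L1 * N t) * exp (- k * t)) has_real_derivative
          (L1 * (inner (F t) (hess d f (x + t *\<^sub>R v) v) / N t) - k * (L0 + L1 * N t)) * exp (- k * t)) (at t)"
        by (auto intro!: derivative_eq_intros N' simp: algebra_simps)
      show "(L1 * (inner (F t) (hess d f (x + t *\<^sub>R v) v) / N t) - k * (L0 + L1 * N t)) * exp (- k * t) \<le> 0"
        using le by (intro mult_nonpos_nonneg) auto
    qed
  qed simp
  then have "L0 + L1 * N 1 \<le> exp k * (L0 + L1 * N 0)"
    by (simp add: exp_minus field_simps)
  moreover have "ell y \<le> L0 + L1 * N 1"
    using FN [of 1] L1 by (simp add: F_def v_def)
  moreover have "N 0 = sqrt ((norm (g x))\<^sup>2 + e)"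
    by (simp add: N_def F_def power2_norm_eq_inner)
  ultimately show ?thesis by (simp add: k_def v_def)
qed

text \<open>The regularisation \<open>e\<close> tends to 0 from the right.\<close>

lemma ell_growth:
  assumes "x \<in> Rd d" "y \<in> Rd d"
  shows "ell y \<le> exp (L1 * norm (y - x)) * ell x"
proof (rule tendsto_lowerbound)
  have "((\<lambda>e. exp (L1 * norm (y - x)) * (L0 + L1 * sqrt ((norm (g x))\<^sup>2 + e)))
      \<longlongrightarrow> exp (L1 * norm (y - x)) * (L0 + L1 * sqrt ((norm (g x))\<^sup>2 + 0))) (at_right 0)"
    by (intro tendsto_intros)
  then show "((\<lambda>e. exp (L1 * norm (y - x)) * (L0 + L1 * sqrt ((norm (g x))\<^sup>2 + e)))
      \<longlongrightarrow> exp (L1 * norm (y - x)) * ell x) (at_right 0)"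
    by simp
  show "\<forall>\<^sub>F e in at_right 0. ell y \<le> exp (L1 * norm (y - x)) * (L0 + L1 * sqrt ((norm (g x))\<^sup>2 + e))"
    using ell_growth_reg [OF assms] eventually_at_right_less [of 0] by (auto elim!: eventually_mono)
qed simp

text \<open>Mean value inequality along the segment, on which \<open>ell_growth\<close> keeps the
  local Hessian bound under control.\<close>

lemma grad_lipschitz_near:
  assumes x: "x \<in> Rd d" and y: "y \<in> Rd d"
  shows "norm (g y - g x) \<le> exp (L1 * norm (y - x)) * ell x * norm (y - x)"
proof -
  define v where "v = y - x"
  have v: "v \<in> Rd d" using x y by (simp add: v_def)
  have "norm (g (x + 1 *\<^sub>R v) - g (x + 0 *\<^sub>R v)) \<le> exp (L1 * norm v) * ell x * norm v * norm (1 - 0 :: real)"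
  proof (rule differentiable_bound [where S = "{0..1}" and f = "\<lambda>t. g (x + t *\<^sub>R v)"])
    fix t :: real assume t: "t \<in> {0..1}"
    show "((\<lambda>t. g (x + t *\<^sub>R v)) has_derivative (\<lambda>s. s *\<^sub>R hess d f (x + t *\<^sub>R v) v)) (at t within {0..1})"
      using g_line [OF x v, of t] by (auto simp: has_vector_derivative_def intro: has_derivative_at_withinI)
    have "norm (hess d f (x + t *\<^sub>R v) v) \<le> ell (x + t *\<^sub>R v) * norm v"
      using x v by (intro hess_bound) auto
    also have "\<dots> \<le> exp (L1 * norm (t *\<^sub>R v)) * ell x * norm v"
      using ell_growth [OF x, of "x + t *\<^sub>R v"] x v by (intro mult_right_mono) auto
    also have "\<dots> \<le> exp (L1 * norm v) * ell x * norm v"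
      using t L1 by (intro mult_right_mono) (auto intro!: mult_left_le_one_le)
    finally show "onorm (\<lambda>s. s *\<^sub>R hess d f (x + t *\<^sub>R v) v) \<le> exp (L1 * norm v) * ell x * norm v"
      by (simp add: onorm_scaleR_left [OF bounded_linear_ident] onorm_id)
  qed auto
  then show ?thesis by (simp add: v_def)
qed

text \<open>On the segment the gradient changes at most at rate \<open>l\<close> from its value at
  \<open>x\<close>, so \<open>f\<close> minus its quadratic model is nonincreasing along
  \<open>v\<close>.\<close>

lemma descent:
  assumes x: "x \<in> Rd d" and v: "v \<in> Rd d" and l: "exp (L1 * norm v) * ell x \<le> l"
  shows "f (x + v) \<le> f x + inner (g x) v + l / 2 * (norm v)\<^sup>2"
proof -
  have "f (x + 1 *\<^sub>R v) - 1 * inner (g x) v - l / 2 * (norm v)\<^sup>2 * 1\<^sup>2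
      \<le> f (x + 0 *\<^sub>R v) - 0 * inner (g x) v - l / 2 * (norm v)\<^sup>2 * 0\<^sup>2"
  proof (rule DERIV_nonpos_imp_nonincreasing
      [of 0 1 "\<lambda>t. f (x + t *\<^sub>R v) - t * inner (g x) v - l / 2 * (norm v)\<^sup>2 * t\<^sup>2"])
    fix t :: real assume t: "0 \<le> t" "t \<le> 1"
    have "norm (g (x + t *\<^sub>R v) - g x) \<le> exp (L1 * norm (t *\<^sub>R v)) * ell x * norm (t *\<^sub>R v)"
      using grad_lipschitz_near [OF x, of "x + t *\<^sub>R v"] x v by auto
    also have "\<dots> \<le> exp (L1 * norm v) * ell x * norm (t *\<^sub>R v)"
      using t L1 by (intro mult_right_mono) (auto intro!: mult_left_le_one_le)
    also have "\<dots> \<le> l * norm (t *\<^sub>R v)"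
      using l by (intro mult_right_mono) auto
    finally have "norm (g (x + t *\<^sub>R v) - g x) \<le> l * (t * norm v)" using t by simp
    then have "inner (g (x + t *\<^sub>R v) - g x) v \<le> l * (t * norm v) * norm v"
      by (rule order_trans [OF norm_cauchy_schwarz mult_right_mono]) simp
    also have "\<dots> = l * (norm v)\<^sup>2 * t" by (simp add: power2_eq_square)
    finally have le: "inner (g (x + t *\<^sub>R v)) v - inner (g x) v - l * (norm v)\<^sup>2 * t \<le> 0"
      by (simp add: inner_diff_left)
    show "\<exists>y. ((\<lambda>t. f (x + t *\<^sub>R v) - t * inner (g x) v - l / 2 * (norm v)\<^sup>2 * t\<^sup>2)
        has_real_derivative y) (at t) \<and> y \<le> 0"
    proof (intro exI conjI)
      show "((\<lambda>t. f (x + t *\<^sub>R v) - t * inner (g x) v - l / 2 * (norm v)\<^sup>2 * t\<^sup>2)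
          has_real_derivative inner (g (x + t *\<^sub>R v)) v - inner (g x) v - l * (norm v)\<^sup>2 * t) (at t)"
        by (auto intro!: derivative_eq_intros f_line [OF x v])
    qed (rule le)
  qed simp
  then show ?thesis by simp
qed

section \<open>Convexity, Bregman divergences and the curvature estimator\<close>

lemma gradient_inequality:
  assumes x: "x \<in> Rd d" and y: "y \<in> Rd d"
  shows "f x + inner (g x) (y - x) \<le> f y"
proof -
  \<comment> \<open>On the line through \<open>x\<close> and \<open>y\<close> the claim is the
    tangent bound for a convex function of one variable.\<close>
  define h where "h t = f (x + t *\<^sub>R (y - x))" for t
  have "convex_on UNIV h"
  proof (rule convex_onI)
    fix t s u :: real assume t: "0 < t" "t < 1"
    have eq: "x + ((1 - t) *\<^sub>R s + t *\<^sub>R u) *\<^sub>R (y - x)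
        = (1 - t) *\<^sub>R (x + s *\<^sub>R (y - x)) + t *\<^sub>R (x + u *\<^sub>R (y - x))"
      by (simp add: algebra_simps)
    show "h ((1 - t) *\<^sub>R s + t *\<^sub>R u) \<le> (1 - t) * h s + t * h u"
      unfolding h_def eq using t x y by (intro convex_onD [OF conv]) auto
  qed simp
  then have "h 1 - h 0 \<ge> inner (g (x + 0 *\<^sub>R (y - x))) (y - x) * (1 - 0)"
    by (rule convex_on_imp_above_tangent) (use f_line [of x "y - x" 0] x y in \<open>auto simp: h_def [abs_def]\<close>)
  then show ?thesis by (simp add: h_def)
qed

abbreviation "breg \<equiv> bregman d f"

lemma breg_nonneg: "x \<in> Rd d \<Longrightarrow> z \<in> Rd d \<Longrightarrow> 0 \<le> breg x z"
  using gradient_inequality [of z x] by (simp add: bregman_def)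

text \<open>The Bregman divergence in \<open>x\<close> is minimised at \<open>z\<close>; compare it with the value after one gradient
  step from \<open>x\<close>, whose length is at most \<open>1 / L1\<close>.\<close>

lemma breg_lower:
  assumes x: "x \<in> Rd d" and z: "z \<in> Rd d"
  shows "(norm (g x - g z))\<^sup>2 \<le> 2 * (exp 1 * (L0 + L1 * (norm (g x) + norm (g z)))) * breg x z"
proof -
  define w where "w = g x - g z"
  \<comment> \<open>This \<open>l\<close> is at least \<open>L1 * norm w\<close>, which keeps the
    length of the step \<open>v\<close> below \<open>1 / L1\<close>, and at least
    \<open>exp 1 * ell x\<close>, which is then enough for \<open>descent\<close>.\<close>
  define l where "l = exp 1 * (L0 + L1 * (norm (g x) + norm (g z)))"
  define v where "v = - ((1 / l) *\<^sub>R w)"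
  have w: "w \<in> Rd d" using x z by (simp add: w_def)
  then have v: "v \<in> Rd d" using Rd_closed(4) [of w d "- (1 / l)"] by (simp add: v_def)
  have e1: "(1::real) \<le> exp 1" by simp
  have S: "0 < L0 + L1 * (norm (g x) + norm (g z))"
    using L0 L1 by (simp add: add_pos_nonneg)
  then have l0: "0 < l" by (simp add: l_def)
  have "L1 * norm w \<le> L1 * (norm (g x) + norm (g z))"
    using L1 norm_triangle_ineq4 [of "g x" "g z"] by (simp add: w_def)
  also have "\<dots> \<le> 1 * (L0 + L1 * (norm (g x) + norm (g z)))" using L0 by simp
  also have "\<dots> \<le> l" unfolding l_def using S by (intro mult_right_mono e1) simp
  finally have "L1 * norm v \<le> 1"
    using l0 by (simp add: v_def field_simps)
  then have "exp (L1 * norm v) * ell x \<le> exp 1 * ell x"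
    by (intro mult_right_mono) auto
  also have "\<dots> \<le> l" unfolding l_def using L1 by (intro mult_left_mono) auto
  finally have "f (x + v) \<le> f x + inner (g x) v + l / 2 * (norm v)\<^sup>2"
    by (rule descent [OF x v])
  moreover have "f z + inner (g z) (x + v - z) \<le> f (x + v)"
    using gradient_inequality [OF z, of "x + v"] x v by simp
  ultimately have "- inner w v - l / 2 * (norm v)\<^sup>2 \<le> breg x z"
    by (simp add: bregman_def w_def inner_diff_left inner_diff_right inner_add_right)
  moreover have "- inner w v - l / 2 * (norm v)\<^sup>2 = (norm w)\<^sup>2 / (2 * l)"
    unfolding v_def using l0
    by (simp add: power_mult_distrib power_divide flip: power2_norm_eq_inner) (simp add: field_simps power2_eq_square)
  ultimately have "(norm w)\<^sup>2 / (2 * l) \<le> breg x z" by simp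
  then have "(norm w)\<^sup>2 \<le> 2 * l * breg x z" using l0 by (simp add: divide_le_eq mult_ac)
  then show ?thesis by (simp add: w_def l_def)
qed

text \<open>Dividing \<open>breg_lower\<close> by the squared gradient difference bounds the
  estimator below by gradient norms alone; this is what keeps the stepsizes from collapsing.\<close>

lemma curv_lower:
  assumes x: "x \<in> Rd d" and z: "z \<in> Rd d"
  shows "ereal (1 / (exp 1 * (L0 + L1 * (norm (g x) + norm (g z))))) \<le> curv d f x z"
proof (cases "g x = g z")
  case False
  have "0 < exp 1 * (L0 + L1 * (norm (g x) + norm (g z)))"
    using L0 L1 by (simp add: add_pos_nonneg)
  then show ?thesis using breg_lower [OF x z] False by (simp add: curv_def field_simps)
qed (simp add: curv_def)

text \<open>If the gradients agree, the estimator is infinite, but the left side vanishes and the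
  divergence is nonnegative.\<close>

lemma le_curv_imp:
  assumes "ereal l \<le> curv d f x z" "x \<in> Rd d" "z \<in> Rd d"
  shows "l * (norm (g x - g z))\<^sup>2 \<le> 2 * breg x z"
  using assms breg_nonneg by (auto simp: curv_def field_simps split: if_splits)

end

section \<open>Growth of the accumulated stepsizes\<close>

lemma one_minus_inverse_le_ln:
  fixes x :: real
  assumes "0 < x" shows "1 - 1 / x \<le> ln x"
  using ln_le_minus_one [of "1 / x"] assms by (simp add: ln_div)

text \<open>The alternatives in \<open>a_Suc_ge\<close> are a full increase and a step limited by
  the curvature estimator. At \<open>k = 0\<close> the index \<open>k - 1\<close> is again
  0.\<close>

locale growth =
  fixes A a :: "nat \<Rightarrow> real" and q \<gamma> c r :: real
  assumes q: "0 \<le> q" and \<gamma>: "0 < \<gamma>" and c: "0 < c" "c \<le> 1" and r: "0 \<le> r"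
    and A_0: "A 0 = a 0" "A 0 \<le> 1"
    and a_pos: "\<And>k. 0 < a k"
    and A_Suc: "\<And>k. A (Suc k) = A k + a (Suc k)"
    and a_Suc_le: "\<And>k. a (Suc k) \<le> (1 + \<gamma>) * a k"
    and a_Suc_ge: "\<And>k. a (Suc k) = (1 + \<gamma>) * a k \<or>
      c * exp (- r * q * max (a k / A k) (a (k - 1) / A (k - 1))) *
        (A (k - 1) / a (k - 1)) * (A k / (A k + q\<^sup>2)) \<le> a (Suc k)"
begin

definition Q :: real where "Q = 1 + q\<^sup>2"

text \<open>\<open>w\<close> is the step size relative to the larger of the scales \<open>sqrt (A k)\<close> and \<open>A k / Q\<close>;
  a step with \<open>w k \<ge> 1\<close> increases \<open>sqrt (A k) + Q * ln (A k)\<close> by a constant.\<close>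

definition w :: "nat \<Rightarrow> real" where
  "w k = a k / A k * (sqrt (A k) + Q)"

text \<open>Increments of the potential \<open>sqrt (A k) + Q * ln (A k)\<close>. The value
  \<open>Q\<close> at 0 makes the two lower bounds below hold there too, as
  \<open>a 0 = A 0 \<le> 1\<close>.\<close>

definition gain :: "nat \<Rightarrow> real" where
  "gain k = (case k of 0 \<Rightarrow> Q
    | Suc j \<Rightarrow> sqrt (A (Suc j)) + Q * ln (A (Suc j)) - (sqrt (A j) + Q * ln (A j)))"

lemma Q_ge: "1 \<le> Q" "q \<le> Q" "q\<^sup>2 \<le> Q\<^sup>2"
proof -
  show "1 \<le> Q" by (simp add: Q_def)
  show "q \<le> Q" using sum_power2_ge_zero [of "q - 1/2" 0] by (simp add: Q_def power2_eq_square algebra_simps)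
  with q show "q\<^sup>2 \<le> Q\<^sup>2" by (intro power_mono)
qed

lemma A_pos: "0 < A k"
  using A_0 a_pos by (induction k) (auto simp: A_Suc intro: add_pos_pos)

lemma a_le_A: "a k \<le> A k"
  using A_0 less_imp_le [OF A_pos] by (cases k) (auto simp: A_Suc)

lemma A_mono: "A k \<le> A (Suc k)"
  using a_pos [of "Suc k"] by (simp add: A_Suc)

lemma A_Suc_le: "A (Suc k) \<le> (2 + \<gamma>) * A k"
proof -
  have "(1 + \<gamma>) * a k \<le> (1 + \<gamma>) * A k" using \<gamma> a_le_A by (intro mult_left_mono) auto
  with a_Suc_le [of k] show ?thesis by (simp add: A_Suc algebra_simps)
qed

lemma w_pos: "0 < w k"
  using a_pos A_pos [of k] Q_ge by (simp add: w_def add_nonneg_pos)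

text \<open>For positive \<open>k\<close>, the logarithmic part of the gain is at least
  \<open>Q * (a k / A k)\<close> by \<open>1 - 1 / x \<le> ln x\<close>, and the square-root part is
  at least half of \<open>a k / A k * sqrt (A k)\<close>.\<close>

lemma
  shows gain_ge_u: "Q * (a k / A k) \<le> gain k"
    and gain_ge_w: "w k / 2 \<le> gain k"
proof -
  have "Q * (a k / A k) \<le> gain k \<and> w k / 2 \<le> gain k"
  proof (cases k)
    case 0
    have "sqrt (A 0) \<le> 1" using A_0 by simp
    then have "sqrt (A 0) \<le> Q" using Q_ge by linarith
    then show ?thesis using 0 A_0 A_pos [of 0] Q_ge by (simp add: gain_def w_def)
  next
    case (Suc j)
    define s t where "s = sqrt (A j)" and "t = sqrt (A k)"
    have st: "0 < s" "s \<le> t" "s\<^sup>2 = A j" "t\<^sup>2 = A k"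
      using A_pos [of j] A_pos [of k] A_mono [of j] Suc by (auto simp: s_def t_def)
    have a: "a k = t\<^sup>2 - s\<^sup>2" using A_Suc [of j] Suc st by simp
    have "a k / A k = 1 - 1 / (A k / A j)"
      using A_pos [of j] A_pos [of k] st a by (simp add: field_simps)
    also have "\<dots> \<le> ln (A k / A j)"
      using A_pos by (intro one_minus_inverse_le_ln) simp
    finally have ln: "Q * (a k / A k) \<le> Q * (ln (A k) - ln (A j))"
      using Q_ge A_pos [of k] A_pos [of j] by (intro mult_left_mono) (auto simp: ln_div)
    have "(t\<^sup>2 - s\<^sup>2) * t \<le> (t - s) * 2 * t * t"
    proof -
      have "0 \<le> (t - s)\<^sup>2 * t" using st by simp
      then show ?thesis by (simp add: power2_eq_square algebra_simps)
    qed
    then have sq: "a k / A k * t \<le> 2 * (t - s)"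
      using st A_pos [of k] unfolding a st(4) [symmetric] by (simp add: divide_le_eq power2_eq_square mult_ac)
    have gk: "gain k = (t - s) + Q * (ln (A k) - ln (A j))"
      by (simp add: gain_def Suc s_def t_def algebra_simps)
    have "0 \<le> Q * (ln (A k) - ln (A j))"
      using Q_ge A_pos [of j] A_mono [of j] Suc by (intro mult_nonneg_nonneg) auto
    then have "0 \<le> gain k - (t - s)" by (simp add: gk)
    moreover have "Q * (a k / A k) \<le> gain k - (t - s)" using ln by (simp add: gk)
    moreover have "w k = a k / A k * t + Q * (a k / A k)" by (simp add: w_def t_def distrib_left)
    ultimately show ?thesis using sq st by (smt (verit) field_sum_of_halves)
  qed
  then show "Q * (a k / A k) \<le> gain k" "w k / 2 \<le> gain k" by auto
qed

lemma gain_ge_ln: "ln (A (Suc k) / A k) \<le> gain (Suc k)"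
proof -
  have l: "0 \<le> ln (A (Suc k) / A k)"
    using A_pos [of k] A_mono [of k] by (intro ln_ge_zero) simp
  have "ln (A (Suc k) / A k) \<le> Q * ln (A (Suc k) / A k)"
    using mult_right_mono [OF Q_ge(1) l] by simp
  also have "\<dots> = Q * (ln (A (Suc k)) - ln (A k))"
    using A_pos [of k] A_pos [of "Suc k"] by (simp add: ln_div)
  finally have "ln (A (Suc k) / A k) \<le> Q * (ln (A (Suc k)) - ln (A k))" .
  moreover have "sqrt (A k) \<le> sqrt (A (Suc k))" using A_mono by simp
  ultimately show ?thesis unfolding gain_def nat.case right_diff_distrib by linarith
qed

section \<open>Accumulated gains and the number of steps\<close>

definition T :: "nat \<Rightarrow> real" where "T k = sum gain {..<k}"

lemma gain_nonneg: "0 \<le> gain k"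
  using gain_ge_w [of k] w_pos [of k] by linarith

text \<open>The window from \<open>k - 1\<close> to \<open>k + 1\<close> contains every gain that
  the step from \<open>k\<close> to \<open>Suc k\<close> draws on; at \<open>k = 0\<close> two of
  the three indices coincide.\<close>

lemma T_diff:
  "gain (Suc k) \<le> T (k + 2) - T (k - 1)"
  "gain k \<le> T (k + 2) - T (k - 1)"
  "gain (k - 1) \<le> T (k + 2) - T (k - 1)"
proof -
  have "{..<k + 2} = insert (Suc k) (insert k (insert (k - 1) {..<k - 1}))"
    by auto
  then have eq: "T (k + 2) - T (k - 1) = sum gain {Suc k, k, k - 1}"
    by (cases k) (auto simp: T_def lessThan_Suc)
  have *: "gain j \<le> T (k + 2) - T (k - 1)" if "j \<in> {Suc k, k, k - 1}" for j
    unfolding eq by (rule member_le_sum) (use that gain_nonneg in simp_all)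
  show "gain (Suc k) \<le> T (k + 2) - T (k - 1)" "gain k \<le> T (k + 2) - T (k - 1)"
    "gain (k - 1) \<le> T (k + 2) - T (k - 1)"
    by (rule *, simp)+
qed

lemma T_Suc: "T (Suc k) = Q + (sqrt (A k) + Q * ln (A k)) - (sqrt (A 0) + Q * ln (A 0))"
  unfolding T_def by (induction k) (auto simp: gain_def)

lemma T_mono: "j \<le> k \<Longrightarrow> T j \<le> T k"
  unfolding T_def using gain_nonneg by (intro sum_mono2) auto

text \<open>One factor \<open>2 + \<gamma>\<close> is lost in passing from
  \<open>sqrt (A k) + Q\<close> to index \<open>k - 1\<close>, the other in passing from
  \<open>A k\<close> to \<open>A (Suc k)\<close>.\<close>

definition c' :: real where "c' = c / (2 + \<gamma>)\<^sup>2"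

lemma c': "0 < c'" "c' \<le> 1"
proof -
  have "1 \<le> (2 + \<gamma>)\<^sup>2" using \<gamma> by (intro one_le_power) auto
  with c have "c \<le> (2 + \<gamma>)\<^sup>2" by linarith
  with c \<gamma> show "0 < c'" "c' \<le> 1" by (auto simp: c'_def divide_le_eq)
qed

text \<open>In the limited case \<open>A k + q\<^sup>2\<close> is at most the square of
  \<open>sqrt (A k) + Q\<close>. One of these factors turns \<open>a (Suc k)\<close> into
  \<open>w (Suc k)\<close>; the other, together with the reciprocal of
  \<open>a (k - 1) / A (k - 1)\<close>, produces \<open>w (k - 1)\<close>.\<close>

lemma w_Suc:
  "(1 + \<gamma>) * w k * (A k / A (Suc k)) \<le> w (Suc k) \<or>
   c' * exp (- r * q * max (a k / A k) (a (k - 1) / A (k - 1))) \<le> w (Suc k) * w (k - 1)"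
proof (rule disj_forward [OF a_Suc_ge [of k]])
  assume a: "a (Suc k) = (1 + \<gamma>) * a k"
  have "(1 + \<gamma>) * w k * (A k / A (Suc k)) = a (Suc k) / A (Suc k) * (sqrt (A k) + Q)"
    using A_pos [of k] A_pos [of "Suc k"] by (simp add: w_def a field_simps)
  also have "\<dots> \<le> w (Suc k)"
    unfolding w_def using A_mono [of k] A_pos [of "Suc k"] a_pos [of "Suc k"]
    by (intro mult_left_mono) auto
  finally show "(1 + \<gamma>) * w k * (A k / A (Suc k)) \<le> w (Suc k)" .
next
  define E where "E = exp (- r * q * max (a k / A k) (a (k - 1) / A (k - 1)))"
  define j where "j = k - 1"
  define S where "S = sqrt (A k) + Q"
  assume "c * exp (- r * q * max (a k / A k) (a (k - 1) / A (k - 1))) *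
        (A (k - 1) / a (k - 1)) * (A k / (A k + q\<^sup>2)) \<le> a (Suc k)"
  then have le: "c * E * (A j / a j) * (A k / (A k + q\<^sup>2)) \<le> a (Suc k)"
    by (simp add: E_def j_def)
  have S: "0 < S" using Q_ge A_pos [of k] by (simp add: S_def add_nonneg_pos)
  have Sj: "S \<le> (2 + \<gamma>) * (sqrt (A j) + Q)"
  proof -
    \<comment> \<open>The square is chosen because its root is again
      \<open>2 + \<gamma>\<close>.\<close>
    have Ak: "A k \<le> (2 + \<gamma>)\<^sup>2 * A j"
    proof (cases k)
      case 0
      have "1 \<le> (2 + \<gamma>)\<^sup>2" using \<gamma> by (intro one_le_power) auto
      then show ?thesis using 0 A_pos [of 0] by (simp add: j_def)
    next
      case (Suc i)
      have "(2 + \<gamma>) * A i \<le> (2 + \<gamma>)\<^sup>2 * A i"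
        using \<gamma> A_pos [of i] by (intro mult_right_mono) (auto simp: power2_eq_square)
      with A_Suc_le [of i] Suc show ?thesis by (simp add: j_def)
    qed
    have "sqrt (A k) \<le> sqrt ((2 + \<gamma>)\<^sup>2 * A j)" using Ak by (rule real_sqrt_le_mono)
    also have "\<dots> = (2 + \<gamma>) * sqrt (A j)" using \<gamma> by (simp add: real_sqrt_mult)
    finally have 1: "sqrt (A k) \<le> (2 + \<gamma>) * sqrt (A j)" .
    have "1 * Q \<le> (2 + \<gamma>) * Q" using \<gamma> Q_ge by (intro mult_right_mono) auto
    with 1 show ?thesis by (simp add: S_def distrib_left)
  qed
  have SS: "A k + q\<^sup>2 \<le> S\<^sup>2"
  proof -
    have "0 \<le> 2 * sqrt (A k) * Q" using A_pos [of k] Q_ge by simp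
    then show ?thesis using A_pos [of k] Q_ge(3) unfolding S_def power2_sum
      by (simp only: real_sqrt_pow2 less_imp_le)
  qed
  have "c' * E = c * E * (S * S / (2 + \<gamma>)\<^sup>2) / S\<^sup>2"
    using S by (simp add: c'_def power2_eq_square)
  also have "\<dots> \<le> c * E * (S * S / (2 + \<gamma>)\<^sup>2) / (A k + q\<^sup>2)"
    using SS c S A_pos [of k] \<gamma> by (intro divide_left_mono) (auto simp: E_def add_pos_nonneg)
  also have "\<dots> = c * E / (A k + q\<^sup>2) * (S / (2 + \<gamma>)) * (S * (1 / (2 + \<gamma>)))"
    by (simp add: power2_eq_square mult_ac)
  also have "\<dots> \<le> c * E / (A k + q\<^sup>2) * (sqrt (A j) + Q) * ((sqrt (A (Suc k)) + Q) * (A k / A (Suc k)))"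
  proof (intro mult_mono)
    show "S / (2 + \<gamma>) \<le> sqrt (A j) + Q" using Sj \<gamma> by (simp add: field_simps)
    show "S \<le> sqrt (A (Suc k)) + Q" using A_mono by (simp add: S_def)
    show "1 / (2 + \<gamma>) \<le> A k / A (Suc k)"
      using A_Suc_le [of k] A_pos [of "Suc k"] \<gamma> by (simp add: field_simps)
  qed (use c S A_pos [of k] A_pos [of "Suc k"] A_pos [of j] Q_ge \<gamma> in \<open>auto simp: E_def add_nonneg_nonneg intro!: mult_nonneg_nonneg divide_nonneg_nonneg\<close>)
  also have "\<dots> = (c * E * (A j / a j) * (A k / (A k + q\<^sup>2))) / A (Suc k) * (sqrt (A (Suc k)) + Q) * w j"
  proof -
    have "sqrt (A j) + Q = A j / a j * w j" using A_pos [of j] a_pos [of j] by (simp add: w_def)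
    then show ?thesis by (simp add: mult_ac)
  qed
  also have "\<dots> \<le> a (Suc k) / A (Suc k) * (sqrt (A (Suc k)) + Q) * w j"
    using A_pos [of "Suc k"] Q_ge w_pos [of j] le by (intro mult_right_mono divide_right_mono) (auto simp: less_imp_le)
  finally show "c' * exp (- r * q * max (a k / A k) (a (k - 1) / A (k - 1))) \<le> w (Suc k) * w (k - 1)"
    by (simp add: E_def j_def w_def)
qed

text \<open>The summand 2 pays for \<open>w (Suc k) \<ge> 1\<close> and for the growth of
  \<open>A\<close>, \<open>r\<close> for the exponential factor, and \<open>2 / c'\<close> for a
  large \<open>w (k - 1)\<close>.\<close>

definition \<kappa> :: real where "\<kappa> = 2 + r + 2 / c'"

text \<open>Three cases: \<open>w (Suc k) \<ge> 1\<close> forces a gain of at least 1/2; a full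
  increase multiplies \<open>w\<close> by \<open>1 + \<gamma>\<close> up to the growth of
  \<open>A\<close>; a limited step is poor only if \<open>w (k - 1)\<close> or one of the last two
  ratios \<open>a / A\<close> was large, which the window records.\<close>

lemma potential_step:
  "min 1 (ln (1 + \<gamma>)) \<le> \<kappa> * (T (k + 2) - T (k - 1)) + min (ln (w (Suc k))) 0 - min (ln (w k)) 0"
proof -
  define G where "G = T (k + 2) - T (k - 1)"
  have G: "gain (Suc k) \<le> G" "gain k \<le> G" "gain (k - 1) \<le> G"
    unfolding G_def by (rule T_diff)+
  have G0: "0 \<le> G" using G(1) gain_nonneg order_trans by blast
  have Gw: "w (Suc k) / 2 \<le> G" "w (k - 1) / 2 \<le> G"
    using gain_ge_w G order_trans by blast+
  have kG: "\<kappa> * G = 2 * G + r * G + 2 / c' * G"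
    by (simp add: \<kappa>_def distrib_right)
  have nn: "0 \<le> r * G" "0 \<le> 2 / c' * G"
    using r G0 c'(1) by auto
  consider "1 \<le> w (Suc k)" | "w (Suc k) < 1" "(1 + \<gamma>) * w k * (A k / A (Suc k)) \<le> w (Suc k)"
    | "w (Suc k) < 1" "c' * exp (- r * q * max (a k / A k) (a (k - 1) / A (k - 1))) \<le> w (Suc k) * w (k - 1)"
    using w_Suc [of k] by linarith
  then have "min 1 (ln (1 + \<gamma>)) \<le> \<kappa> * G + min (ln (w (Suc k))) 0 - min (ln (w k)) 0"
  proof cases
    case 1
    then have "min (ln (w (Suc k))) 0 = 0" by simp
    moreover have "1 \<le> 2 * G" using 1 Gw by simp
    ultimately show ?thesis using kG nn by linarith
  next
    case 2
    have "ln (1 + \<gamma>) + ln (w k) - ln (A (Suc k) / A k) = ln ((1 + \<gamma>) * w k * (A k / A (Suc k)))"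
      using \<gamma> w_pos [of k] A_pos [of k] A_pos [of "Suc k"] by (simp add: ln_mult ln_div)
    also have "\<dots> \<le> ln (w (Suc k))"
      using 2 \<gamma> w_pos [of k] A_pos [of k] A_pos [of "Suc k"] by (intro ln_mono) auto
    finally have "ln (1 + \<gamma>) + ln (w k) - ln (A (Suc k) / A k) \<le> ln (w (Suc k))" .
    moreover have "ln (A (Suc k) / A k) \<le> G" using gain_ge_ln G order_trans by blast
    moreover have "ln (w (Suc k)) < 0" using 2 w_pos by simp
    ultimately show ?thesis using kG nn G0 by linarith
  next
    case 3
    define m where "m = max (a k / A k) (a (k - 1) / A (k - 1))"
    have "ln c' - r * q * m = ln (c' * exp (- r * q * m))"
      using c'(1) by (simp add: ln_mult)
    also have "\<dots> \<le> ln (w (Suc k) * w (k - 1))"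
      using 3 c'(1) by (intro ln_mono) (auto simp: m_def)
    also have "\<dots> = ln (w (Suc k)) + ln (w (k - 1))"
      by (intro ln_mult_pos w_pos)
    finally have *: "ln c' - r * q * m \<le> ln (w (Suc k)) + ln (w (k - 1))" .
    have m0: "0 \<le> m" using a_pos [of k] A_pos [of k] by (simp add: m_def le_max_iff_disj)
    have "q * m \<le> Q * m" using Q_ge m0 by (intro mult_right_mono) auto
    also have "\<dots> \<le> G"
      using gain_ge_u [of k] gain_ge_u [of "k - 1"] G by (auto simp: m_def max_def)
    finally have "r * q * m \<le> r * G" using r by (simp add: mult.assoc mult_left_mono)
    \<comment> \<open>The \<open>- 1\<close> in \<open>ln y \<le> y - 1\<close>, taken at
      \<open>y = w (k - 1) / c'\<close>, supplies the constant increase in this case.\<close>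
    moreover have "ln (w (k - 1)) - ln c' \<le> 2 / c' * G - 1"
    proof -
      have "ln (w (k - 1)) - ln c' = ln (w (k - 1) / c')"
        by (simp only: ln_divide_pos w_pos c'(1))
      also have "\<dots> \<le> w (k - 1) / c' - 1"
        using w_pos c'(1) by (intro ln_le_minus_one divide_pos_pos)
      also have "w (k - 1) / c' = 2 / c' * (w (k - 1) / 2)" by simp
      also have "\<dots> \<le> 2 / c' * G" using Gw(2) c'(1) by (intro mult_left_mono) simp_all
      finally show ?thesis by simp
    qed
    moreover have "ln (w (Suc k)) < 0" using 3 w_pos by simp
    ultimately show ?thesis using * kG nn G0 by linarith
  qed
  then show ?thesis by (simp add: G_def)
qed

text \<open>Summing \<open>potential_step\<close> counts every gain at most three times. The
  truncated logarithm starts at 0, because \<open>w 0 \<ge> 1\<close>, and is never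
  positive.\<close>

lemma step_count:
  "min 1 (ln (1 + \<gamma>)) * real K \<le> 3 * \<kappa> * (Q + sqrt (A K) + Q * (ln (A K) - ln (A 0)))"
proof -
  have \<kappa>0: "0 \<le> \<kappa>" using r c'(1) by (simp add: \<kappa>_def)
  have "min 1 (ln (1 + \<gamma>)) * real K \<le> \<kappa> * (T (Suc K) + T K + T (K - 1)) + min (ln (w K)) 0"
  proof (induction K)
    case 0
    have "1 \<le> w 0" using A_0 A_pos [of 0] Q_ge by (simp add: w_def add_increasing)
    then show ?case using \<kappa>0 Q_ge by (simp add: T_def gain_def)
  next
    case (Suc K)
    then show ?case using potential_step [of K] by (simp add: algebra_simps)
  qed
  also have "\<dots> \<le> \<kappa> * (T (Suc K) + T (Suc K) + T (Suc K)) + 0"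
    using \<kappa>0 by (intro add_mono mult_left_mono T_mono) auto
  also have "\<dots> = 3 * \<kappa> * T (Suc K)" by simp
  also have "\<dots> \<le> 3 * \<kappa> * (Q + sqrt (A K) + Q * (ln (A K) - ln (A 0)))"
    using \<kappa>0 A_pos [of 0] by (intro mult_left_mono) (auto simp: T_Suc algebra_simps)
  finally show ?thesis .
qed

end

section \<open>The algorithm\<close>

text \<open>For consecutive displacements \<open>p\<close> and \<open>a\<close> with stepsize ratio
  \<open>r\<close>, this reduces the cross term of the extrapolation to the gradient change
  \<open>\<delta>\<close>.\<close>

lemma extrapolated_step_bound:
  fixes p a \<delta> :: "'a::real_inner" and \<theta> r :: real
  assumes a: "a = r *\<^sub>R p - \<delta>" and r: "0 \<le> r" "r \<le> 1 + \<gamma>" and \<theta>: "0 < \<theta>"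
    and \<gamma>: "(1 + \<theta>) * (1 + \<gamma>) \<le> 2 * \<theta>"
  shows "(1 + \<theta>) * (norm a)\<^sup>2 - 2 * \<theta> * inner a p - \<theta> * (norm p)\<^sup>2 \<le> (1 + 2 * \<theta>) * (norm \<delta>)\<^sup>2"
proof -
  define P where "P = inner p p"
  define S where "S = inner p \<delta>"
  define E where "E = inner \<delta> \<delta>"
  define B where "B = \<theta> - (1 + \<theta>) * r"
  have "(1 + \<theta>) * r \<le> (1 + \<theta>) * (1 + \<gamma>)" using r \<theta> by (intro mult_left_mono) auto
  then have rt: "(1 + \<theta>) * r \<le> 2 * \<theta>" using \<gamma> by simp
  \<comment> \<open>After multiplication by \<theta> this square controls the terms in
    \<open>S\<close>; the remaining multiple of \<open>P\<close> is nonpositive by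
    \<open>rt\<close>.\<close>
  have "0 \<le> inner (\<theta> *\<^sub>R p - B *\<^sub>R \<delta>) (\<theta> *\<^sub>R p - B *\<^sub>R \<delta>)" by simp
  then have sq: "2 * \<theta> * B * S \<le> \<theta>\<^sup>2 * P + B\<^sup>2 * E"
    by (simp add: inner_diff_left inner_diff_right P_def S_def E_def inner_commute power2_eq_square algebra_simps)
  have PE: "0 \<le> P" "0 \<le> E" by (simp_all add: P_def E_def)
  have na: "(norm a)\<^sup>2 = r\<^sup>2 * P - 2 * r * S + E"
    unfolding a power2_norm_eq_inner P_def S_def E_def
    by (simp add: inner_diff_left inner_diff_right inner_commute power2_eq_square algebra_simps)
  have np: "(norm p)\<^sup>2 = P" by (simp add: P_def power2_norm_eq_inner)
  have ap: "inner a p = r * P - S"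
    unfolding P_def S_def by (simp add: a inner_diff_left inner_commute [of \<delta> p])
  have "\<theta> * ((1 + \<theta>) * (norm a)\<^sup>2 - 2 * \<theta> * inner a p - \<theta> * (norm p)\<^sup>2)
      = 2 * \<theta> * B * S - \<theta>\<^sup>2 * P + \<theta> * (1 + \<theta>) * E - \<theta> * r * (2 * \<theta> - (1 + \<theta>) * r) * P"
    unfolding na ap np by (simp add: B_def power2_eq_square algebra_simps)
  also have "\<dots> \<le> B\<^sup>2 * E + \<theta> * (1 + \<theta>) * E - \<theta> * r * (2 * \<theta> - (1 + \<theta>) * r) * P"
    using sq by simp
  also have "\<dots> \<le> B\<^sup>2 * E + \<theta> * (1 + \<theta>) * E"
    using \<theta> r rt PE by simp
  also have "B\<^sup>2 * E \<le> \<theta>\<^sup>2 * E"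
  proof (intro mult_right_mono PE)
    have "\<bar>B\<bar> \<le> \<bar>\<theta>\<bar>" using rt \<theta> r by (simp add: B_def abs_le_iff)
    then show "B\<^sup>2 \<le> \<theta>\<^sup>2" by (simp add: abs_le_square_iff)
  qed
  finally have "\<theta> * ((1 + \<theta>) * (norm a)\<^sup>2 - 2 * \<theta> * inner a p - \<theta> * (norm p)\<^sup>2) \<le> \<theta> * ((1 + 2 * \<theta>) * E)"
    by (simp add: power2_eq_square algebra_simps)
  then show ?thesis using \<theta> by (simp add: E_def power2_norm_eq_inner)
qed

section \<open>Iterates, stepsizes and averaging weights\<close>

locale graal = L0L1_convex +
  fixes \<theta> \<gamma> \<nu> :: real and xs x0 :: fseq and eta0 :: real
  assumes \<theta>: "0 < \<theta>" and \<gamma>: "0 < \<gamma>" and \<nu>: "0 < \<nu>"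
    and param1: "4 * \<nu> * \<theta> * (1 + \<gamma>)\<^sup>2 = \<gamma>"
    and param2: "1 + 2 * \<gamma> + 2 * \<gamma> * \<theta>\<^sup>2 / (1 + \<theta>)\<^sup>2 \<le> \<theta> / (1 + \<theta>) + \<theta>\<^sup>2 / (1 + \<theta>)\<^sup>2"
    and xs: "minimizer d f xs" and x0: "x0 \<in> Rd d"
    and eta0: "0 < eta0" "eta0 * L0 * exp (L1 * norm (x0 - xs)) \<le> 1"
begin

definition st :: "nat \<Rightarrow> graal_state" where
  "st k = (graal_step d f \<theta> \<gamma> \<nu> ^^ k) (graal_init x0 eta0)"

definition "x k = pt (st k)"
definition "xb k = pt_bar (st k)"
definition "xt k = pt_tilde (st k)"
definition "\<alpha> k = alpha (st k)"
definition "\<beta> k = beta (st k)"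
definition "\<eta> k = eta (st k)"
definition "h k = H (st k)"

text \<open>In \<open>xh 0\<close>, \<open>h (0 - 1)\<close> and \<open>\<eta> (0 - 1)\<close> the truncated index \<open>0 - 1 = 0\<close>
  matches the conventions for the index \<open>- 1\<close>.\<close>

definition "xh k = x k + \<theta> *\<^sub>R (x k - x (k - 1))"
text \<open>The index is shifted: this value determines the stepsize
  \<open>\<eta> (Suc k)\<close>.\<close>

definition "lam k = min (curv d f (xb (Suc k)) (xt k)) (curv d f (xb (Suc k)) (xt (Suc k)))"

lemma st_Suc: "st (Suc k) = graal_step d f \<theta> \<gamma> \<nu> (st k)"
  by (simp add: st_def)

lemma prev: "eta_prev (st k) = \<eta> (k - 1)" "H_prev (st k) = h (k - 1)"
  by (cases k; simp add: \<eta>_def h_def st_Suc graal_step_def Let_def;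
      simp add: st_def graal_init_def)+

lemma init [simp]:
  "x 0 = x0" "xb 0 = x0" "xt 0 = x0" "\<alpha> 0 = 1" "\<beta> 0 = 1" "\<eta> 0 = eta0" "h 0 = eta0"
  by (simp_all add: x_def xb_def xt_def \<alpha>_def \<beta>_def \<eta>_def h_def st_def graal_init_def)

lemma step:
  "\<alpha> (Suc k) = (1 + \<gamma>) * \<eta> k / (h k + (1 + \<gamma>) * \<eta> k)"
  "x (Suc k) = x k - \<eta> k *\<^sub>R g (xt k)"
  "xb (Suc k) = \<beta> k *\<^sub>R xt k + (1 - \<beta> k) *\<^sub>R xb k"
  "xt (Suc k) = \<alpha> (Suc k) *\<^sub>R xh (Suc k) + (1 - \<alpha> (Suc k)) *\<^sub>R xb (Suc k)"
  "\<eta> (Suc k) = (if lam k = \<infinity> then (1 + \<gamma>) * \<eta> k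
      else min ((1 + \<gamma>) * \<eta> k) (\<nu> * h (k - 1) * real_of_ereal (lam k) / \<eta> (k - 1)))"
  "h (Suc k) = h k + \<eta> (Suc k)"
  "\<beta> (Suc k) = \<eta> (Suc k) / (\<alpha> (Suc k) * h (Suc k))"
  unfolding xh_def lam_def prev [symmetric]
  by (simp_all add: x_def xb_def xt_def \<alpha>_def \<beta>_def \<eta>_def h_def st_Suc graal_step_def Let_def)

lemma xt_eq: "xt k = \<alpha> k *\<^sub>R xh k + (1 - \<alpha> k) *\<^sub>R xb k"
  by (cases k) (simp_all add: step xh_def)

lemma xs_Rd [simp]: "xs \<in> Rd d"
  using xs by (simp add: minimizer_def)

lemma iterates_Rd: "x k \<in> Rd d \<and> xb k \<in> Rd d \<and> xt k \<in> Rd d"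
  by (induction k) (use x0 in \<open>simp_all add: step xh_def\<close>)

lemma Rd_simps [simp]: "x k \<in> Rd d" "xb k \<in> Rd d" "xt k \<in> Rd d" "xh k \<in> Rd d" "g (xt k) \<in> Rd d"
  using iterates_Rd by (auto simp: xh_def)

lemma lam_lower:
  "ereal (1 / (exp 1 * (ell (xb (Suc k)) + L1 * max (norm (g (xt k))) (norm (g (xt (Suc k))))))) \<le> lam k"
proof -
  have *: "ereal (1 / (exp 1 * (ell (xb (Suc k)) + L1 * max (norm (g (xt k))) (norm (g (xt (Suc k)))))))
      \<le> curv d f (xb (Suc k)) z" if z: "z \<in> {xt k, xt (Suc k)}" for z
  proof -
    have "L1 * norm (g z) \<le> L1 * max (norm (g (xt k))) (norm (g (xt (Suc k))))"
      using z L1 by (intro mult_left_mono) auto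
    moreover have "0 < ell (xb (Suc k)) + L1 * norm (g z)" using L0 L1 by (simp add: add_pos_nonneg)
    ultimately have "1 / (exp 1 * (ell (xb (Suc k)) + L1 * max (norm (g (xt k))) (norm (g (xt (Suc k))))))
        \<le> 1 / (exp 1 * (ell (xb (Suc k)) + L1 * norm (g z)))"
      by (intro divide_left_mono mult_left_mono mult_pos_pos) auto
    also have "\<dots> = 1 / (exp 1 * (L0 + L1 * (norm (g (xb (Suc k))) + norm (g z))))"
      by (simp add: algebra_simps)
    finally have "ereal (1 / (exp 1 * (ell (xb (Suc k)) + L1 * max (norm (g (xt k))) (norm (g (xt (Suc k)))))))
        \<le> ereal (1 / (exp 1 * (L0 + L1 * (norm (g (xb (Suc k))) + norm (g z)))))"
      by (simp only: ereal_less_eq)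
    also have "\<dots> \<le> curv d f (xb (Suc k)) z"
      using z by (intro curv_lower) auto
    finally show ?thesis .
  qed
  show ?thesis unfolding lam_def by (intro min.boundedI *) auto
qed

lemma lam_pos: "0 < lam k"
proof -
  have "0 < ell (xb (Suc k)) + L1 * max (norm (g (xt k))) (norm (g (xt (Suc k))))"
    using L0 L1 by (intro add_pos_nonneg) (auto simp: le_max_iff_disj)
  then have "0 < ereal (1 / (exp 1 * (ell (xb (Suc k)) + L1 * max (norm (g (xt k))) (norm (g (xt (Suc k)))))))"
    by simp
  then show ?thesis using lam_lower [of k] by (rule less_le_trans)
qed

lemma lam_cases:
  obtains "lam k = \<infinity>" "\<eta> (Suc k) = (1 + \<gamma>) * \<eta> k"
  | l where "0 < l" "lam k = ereal l" "\<eta> (Suc k) = min ((1 + \<gamma>) * \<eta> k) (\<nu> * h (k - 1) * l / \<eta> (k - 1))"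
proof (cases "lam k")
  case (real l)
  then show ?thesis using lam_pos [of k] that(2) [of l] by (simp add: step)
next
  case PInf
  then show ?thesis using that(1) by (simp add: step)
qed (use lam_pos [of k] in auto)

lemma \<eta>_h_pos: "0 < \<eta> k" "0 < h k"
proof -
  \<comment> \<open>The stepsize rule also refers to index \<open>k - 1\<close>, so the induction
    covers all smaller indices.\<close>
  have "\<forall>j\<le>k. 0 < \<eta> j \<and> 0 < h j"
  proof (induction k)
    case (Suc k)
    then have IH: "0 < \<eta> k" "0 < h k" "0 < \<eta> (k - 1)" "0 < h (k - 1)" by auto
    have "0 < \<eta> (Suc k)"
      by (rule lam_cases [of k]) (use IH \<gamma> \<nu> in auto)
    moreover from this have "0 < h (Suc k)" using IH by (simp add: step(6))
    ultimately show ?case using Suc by (auto simp: le_Suc_eq)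
  qed (use eta0 in simp)
  then show "0 < \<eta> k" "0 < h k" by auto
qed

lemma \<eta>_h_nonneg [simp]: "0 \<le> \<eta> k" "0 \<le> h k" "\<eta> k \<noteq> 0" "h k \<noteq> 0"
  using \<eta>_h_pos [of k] by auto

lemma \<eta>_Suc_le: "\<eta> (Suc k) \<le> (1 + \<gamma>) * \<eta> k"
  by (simp add: step)

lemma h_mono: "h (k - 1) \<le> h k"
  by (cases k) (auto simp: step(6))

lemma \<alpha>_bounds: "0 < \<alpha> k" "\<alpha> k \<le> 1"
proof -
  have "0 < \<alpha> k \<and> \<alpha> k \<le> 1"
  proof (cases k)
    case (Suc j)
    then show ?thesis
      using \<eta>_h_pos [of j] \<gamma> by (simp add: step(1) add_pos_pos divide_le_eq)
  qed simp
  then show "0 < \<alpha> k" "\<alpha> k \<le> 1" by auto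
qed

text \<open>At 0 both sides are 1, because \<open>h 0 = \<eta> 0\<close>.\<close>

lemma \<alpha>_\<beta>: "\<alpha> k * \<beta> k = \<eta> k / h k"
  using \<alpha>_bounds(1) [of k] eta0 by (cases k) (auto simp: step(7))

text \<open>The upper bound amounts to \<open>\<eta> k / h k \<le> \<alpha> k\<close>, which follows
  from \<open>\<eta>_Suc_le\<close> since \<open>e / (c + e)\<close> increases with
  \<open>e\<close>.\<close>

lemma \<beta>_bounds: "0 < \<beta> k" "\<beta> k \<le> 1"
proof -
  have "0 < \<alpha> k * \<beta> k" unfolding \<alpha>_\<beta> using \<eta>_h_pos by simp
  then show "0 < \<beta> k" using \<alpha>_bounds(1) [of k] by (simp add: zero_less_mult_iff)
  show "\<beta> k \<le> 1"
  proof (cases k)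
    case (Suc j)
    have *: "e / (c + e) \<le> b / (c + b)" if "0 < c" "0 < e" "e \<le> b" for c e b :: real
    proof -
      have "e / (c + e) = 1 - c / (c + e)" using that by (simp add: field_simps)
      also have "\<dots> \<le> 1 - c / (c + b)" using that by (intro diff_left_mono divide_left_mono) auto
      also have "\<dots> = b / (c + b)" using that by (simp add: field_simps)
      finally show ?thesis .
    qed
    have "\<alpha> k * \<beta> k \<le> \<alpha> k"
      unfolding \<alpha>_\<beta> unfolding Suc step(1,6) by (intro * \<eta>_h_pos \<eta>_Suc_le)
    then show ?thesis using \<alpha>_bounds(1) [of k] by simp
  qed simp
qed

text \<open>The previous sum, with value 0 before the first step; \<open>h (0 - 1)\<close>, in
  contrast, is \<open>eta0\<close>.\<close>

definition "h' k = h k - \<eta> k"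

lemma h'_Suc [simp]: "h' (Suc k) = h k" and h'_0 [simp]: "h' 0 = 0"
  by (simp_all add: h'_def step)

lemma h'_nonneg: "0 \<le> h' k"
  by (cases k) auto

text \<open>Eliminating \<open>xt\<close> exhibits \<open>xb\<close> as the average of the points
  \<open>xh\<close> with weights \<open>\<eta>\<close>.\<close>

lemma xb_Suc_eq: "h k *\<^sub>R xb (Suc k) = \<eta> k *\<^sub>R xh k + h' k *\<^sub>R xb k"
proof -
  have "xb (Suc k) = (\<alpha> k * \<beta> k) *\<^sub>R xh k + (1 - \<alpha> k * \<beta> k) *\<^sub>R xb k"
    unfolding step(3) xt_eq [of k] by (simp add: algebra_simps)
  also have "\<dots> = (\<eta> k / h k) *\<^sub>R xh k + (h' k / h k) *\<^sub>R xb k"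
    by (simp add: \<alpha>_\<beta> h'_def diff_divide_distrib)
  finally show ?thesis by (simp add: scaleR_add_right)
qed

section \<open>Descent of the Lyapunov function\<close>

definition "\<Phi> k = f (xb k) - f xs"

lemma \<Phi>_nonneg: "0 \<le> \<Phi> k"
  using xs by (simp add: \<Phi>_def minimizer_def)

lemma grad_xs: "g xs = 0"
proof -
  let ?D = "\<lambda>t. f (xs + t *\<^sub>R g xs)"
  have "DERIV ?D 0 :> inner (g xs) (g xs)"
    using f_line [of xs "g xs" 0] by simp
  then have "inner (g xs) (g xs) = 0"
    by (rule DERIV_local_min [of _ _ _ 1]) (use xs in \<open>auto simp: minimizer_def\<close>)
  then show ?thesis by simp
qed

text \<open>Weight of the Bregman divergence in the Lyapunov function; it vanishes for \<open>k = 0\<close> because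
  \<open>h' 0 = 0\<close>.\<close>

definition "W k = h' k * \<eta> k / ((1 + \<gamma>) * \<eta> (k - 1))"

lemma W_nonneg: "0 \<le> W k"
  using h'_nonneg [of k] \<gamma> by (simp add: W_def)

text \<open>The same weight arises twice: as the excess of the Jensen weight of \<open>xt k\<close>
  over \<open>\<eta> k\<close>, and as the factor that converts \<open>\<eta> k\<close> times
  \<open>xh k - xt k\<close> into a multiple of \<open>xt k - xb k\<close>.\<close>

lemma weight_eq: "\<beta> k * h k - \<eta> k = W k" "\<eta> k * (1 - \<alpha> k) / \<alpha> k = W k"
proof -
  have "\<beta> k * h k = \<eta> k / \<alpha> k"
    using \<alpha>_\<beta> [of k] \<alpha>_bounds(1) [of k] by (simp add: field_simps)
  then have *: "\<beta> k * h k - \<eta> k = \<eta> k * (1 - \<alpha> k) / \<alpha> k"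
    using \<alpha>_bounds(1) [of k] by (simp add: field_simps)
  show "\<eta> k * (1 - \<alpha> k) / \<alpha> k = W k"
  proof (cases k)
    case (Suc j)
    define b where "b = (1 + \<gamma>) * \<eta> j"
    have b: "0 < b" "0 < h j" using \<eta>_h_pos [of j] \<gamma> by (simp_all add: b_def)
    have "(1 - \<alpha> k) / \<alpha> k = h j / b"
    proof -
      have "1 - b / (h j + b) = h j / (h j + b)" using b by (simp add: field_simps)
      then show ?thesis unfolding Suc step(1) b_def [symmetric] using b by simp
    qed
    then show ?thesis using b
      by (simp add: Suc W_def flip: b_def times_divide_eq_right) (simp add: mult.commute)
  qed (simp add: W_def)
  with * show "\<beta> k * h k - \<eta> k = W k" by simp
qed

lemma f_xb_Suc: "f (xb (Suc k)) \<le> \<beta> k * f (xt k) + (1 - \<beta> k) * f (xb k)"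
  using convex_onD [OF conv, of "\<beta> k" "xb k" "xt k"] \<beta>_bounds [of k]
  by (simp add: step(3) add.commute)

text \<open>Split \<open>xh k - xs\<close> at \<open>xt k\<close>. The part towards
  \<open>xs\<close> is bounded by convexity, the other is a multiple of \<open>xt k - xb k\<close>
  and yields the divergence exactly; Jensen's inequality then brings in
  \<open>xb (Suc k)\<close>.\<close>

lemma linear_lower:
  "h k * \<Phi> (Suc k) - h' k * \<Phi> k + W k * breg (xb k) (xt k) \<le> \<eta> k * inner (g (xt k)) (xh k - xs)"
proof -
  let ?g = "g (xt k)"
  have \<alpha>0: "\<alpha> k \<noteq> 0" using \<alpha>_bounds(1) [of k] by simp
  have "\<alpha> k *\<^sub>R (xh k - xt k) = (1 - \<alpha> k) *\<^sub>R (xt k - xb k)"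
    unfolding xt_eq [of k] by (simp add: algebra_simps)
  then have "(1 / \<alpha> k) *\<^sub>R (\<alpha> k *\<^sub>R (xh k - xt k)) = (1 / \<alpha> k) *\<^sub>R ((1 - \<alpha> k) *\<^sub>R (xt k - xb k))"
    by simp
  then have "xh k - xt k = ((1 - \<alpha> k) / \<alpha> k) *\<^sub>R (xt k - xb k)"
    using \<alpha>0 by simp
  then have "\<eta> k * inner ?g (xh k - xt k) = W k * inner ?g (xt k - xb k)"
    by (simp add: weight_eq(2) [symmetric])
  also have "inner ?g (xt k - xb k) = f (xt k) - f (xb k) + breg (xb k) (xt k)"
    by (simp add: bregman_def inner_diff_right)
  finally have 1: "\<eta> k * inner ?g (xh k - xt k) = W k * (f (xt k) - f (xb k) + breg (xb k) (xt k))" .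
  have "f (xt k) - f xs \<le> inner ?g (xt k - xs)"
    using gradient_inequality [of "xt k" xs] by (simp add: inner_diff_right)
  then have 2: "\<eta> k * (f (xt k) - f xs) \<le> \<eta> k * inner ?g (xt k - xs)"
    by (intro mult_left_mono) auto
  have 3: "h k * f (xb (Suc k)) \<le> h k * (\<beta> k * f (xt k) + (1 - \<beta> k) * f (xb k))"
    by (intro mult_left_mono f_xb_Suc) auto
  have "inner ?g (xh k - xs) = inner ?g (xh k - xt k) + inner ?g (xt k - xs)"
    by (simp add: inner_diff_right)
  with 1 2 have "W k * (f (xt k) - f (xb k) + breg (xb k) (xt k)) + \<eta> k * (f (xt k) - f xs)
      \<le> \<eta> k * inner ?g (xh k - xs)"
    by (simp add: distrib_left)
  with 3 show ?thesis
    unfolding \<Phi>_def h'_def weight_eq(1) [symmetric] by (simp add: algebra_simps)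
qed

text \<open>The divergence is convex in its first argument and vanishes at \<open>xt k\<close>, and
  \<open>xb (Suc k)\<close> lies between \<open>xb k\<close> and \<open>xt k\<close>.\<close>

lemma breg_xb_Suc: "breg (xb (Suc k)) (xt k) \<le> breg (xb k) (xt k)"
proof -
  have b: "0 \<le> 1 - \<beta> k" "1 - \<beta> k \<le> 1" using \<beta>_bounds [of k] by auto
  have "xb (Suc k) - xt k = (1 - \<beta> k) *\<^sub>R (xb k - xt k)"
    by (simp add: step(3) algebra_simps)
  then have "inner (g (xt k)) (xb (Suc k) - xt k) = (1 - \<beta> k) * inner (g (xt k)) (xb k - xt k)"
    by simp
  with f_xb_Suc [of k] have "breg (xb (Suc k)) (xt k) \<le> (1 - \<beta> k) * breg (xb k) (xt k)"
    unfolding bregman_def by (simp only: right_diff_distrib) (simp add: algebra_simps)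
  also have "\<dots> \<le> breg (xb k) (xt k)"
    using b breg_nonneg [of "xb k" "xt k"] by (intro mult_left_le_one_le) auto
  finally show ?thesis .
qed

text \<open>Both gradients are compared with the one at \<open>xb (Suc k)\<close>: the curvature
  restriction on the stepsize bounds each squared difference by a divergence. If
  \<open>lam k\<close> is infinite, all three gradients coincide.\<close>

lemma grad_change:
  "\<eta> (Suc k) * (norm (g (xt (Suc k)) - g (xt k)))\<^sup>2
    \<le> 4 * \<nu> * (h (k - 1) / \<eta> (k - 1)) * (breg (xb (Suc k)) (xt (Suc k)) + breg (xb (Suc k)) (xt k))"
proof (rule lam_cases [of k])
  assume "lam k = \<infinity>"
  then have "g (xb (Suc k)) = g (xt k)" "g (xb (Suc k)) = g (xt (Suc k))"
    by (auto simp: lam_def curv_def min_def split: if_splits)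
  then show ?thesis using \<nu> breg_nonneg [of "xb (Suc k)"] by simp
next
  fix l assume l: "0 < l" "lam k = ereal l"
    "\<eta> (Suc k) = min ((1 + \<gamma>) * \<eta> k) (\<nu> * h (k - 1) * l / \<eta> (k - 1))"
  define c where "c = \<nu> * (h (k - 1) / \<eta> (k - 1))"
  have c: "0 < c" using \<nu> \<eta>_h_pos by (simp add: c_def)
  let ?b = "g (xb (Suc k))"
  have le: "\<eta> (Suc k) \<le> c * l" using l by (simp add: c_def mult_ac)
  have *: "\<eta> (Suc k) * (norm (?b - g z))\<^sup>2 \<le> 2 * c * breg (xb (Suc k)) z"
    if "z \<in> {xt k, xt (Suc k)}" for z
  proof -
    have "ereal l \<le> curv d f (xb (Suc k)) z"
      using that l(2) [symmetric] by (auto simp: lam_def)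
    then have lz: "l * (norm (?b - g z))\<^sup>2 \<le> 2 * breg (xb (Suc k)) z"
      by (rule le_curv_imp) (use that in auto)
    have "\<eta> (Suc k) * (norm (?b - g z))\<^sup>2 \<le> c * l * (norm (?b - g z))\<^sup>2"
      using le by (intro mult_right_mono) auto
    also have "\<dots> \<le> c * (2 * breg (xb (Suc k)) z)"
      using lz c by (simp add: mult.assoc)
    finally show ?thesis by simp
  qed
  have par: "(norm (u - v))\<^sup>2 \<le> 2 * ((norm (w - u))\<^sup>2 + (norm (w - v))\<^sup>2)" for u v w :: fseq
  proof -
    have "0 \<le> inner (w - u + (w - v)) (w - u + (w - v))" by simp
    then show ?thesis
      by (simp add: power2_norm_eq_inner inner_diff_left inner_diff_right inner_add_left
          inner_add_right inner_commute)
  qed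
  have "\<eta> (Suc k) * (norm (g (xt (Suc k)) - g (xt k)))\<^sup>2
      \<le> \<eta> (Suc k) * (2 * ((norm (?b - g (xt (Suc k))))\<^sup>2 + (norm (?b - g (xt k)))\<^sup>2))"
    by (intro mult_left_mono par) auto
  also have "\<dots> = 2 * (\<eta> (Suc k) * (norm (?b - g (xt (Suc k))))\<^sup>2 + \<eta> (Suc k) * (norm (?b - g (xt k)))\<^sup>2)"
    by (simp add: algebra_simps)
  also have "\<dots> \<le> 2 * (2 * c * breg (xb (Suc k)) (xt (Suc k)) + 2 * c * breg (xb (Suc k)) (xt k))"
    by (intro mult_left_mono add_mono *) auto
  finally show ?thesis by (simp add: c_def algebra_simps)
qed

text \<open>With \<open>t = \<theta> / (1 + \<theta>)\<close>, the second parameter condition and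
  \<open>t\<^sup>2 \<le> t\<close> give \<open>1 + 2 * \<gamma> \<le> 2 * t\<close>.\<close>

lemma param3: "(1 + 2 * \<gamma>) * (1 + \<theta>) \<le> 2 * \<theta>"
proof -
  define t where "t = \<theta> / (1 + \<theta>)"
  have t: "0 \<le> t" "t \<le> 1" "t * (1 + \<theta>) = \<theta>" using \<theta> by (simp_all add: t_def)
  have "1 + 2 * \<gamma> + 2 * \<gamma> * t\<^sup>2 \<le> t + t\<^sup>2"
    using param2 by (simp add: t_def power_divide)
  moreover have "t\<^sup>2 \<le> t" using t by (simp add: power2_eq_square mult_left_le)
  moreover have "0 \<le> 2 * \<gamma> * t\<^sup>2" using \<gamma> by simp
  ultimately have "1 + 2 * \<gamma> \<le> 2 * t" by linarith
  then have "(1 + 2 * \<gamma>) * (1 + \<theta>) \<le> 2 * t * (1 + \<theta>)" using \<theta> by (intro mult_right_mono) auto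
  with t show ?thesis by simp
qed

lemma param_bounds:
  "(1 + \<theta>) * (1 + \<gamma>) \<le> 2 * \<theta>" "\<gamma> * (1 + 2 * \<theta>) \<le> \<theta>" "1 \<le> \<theta>" "\<nu> \<le> 1"
proof -
  have \<gamma>\<theta>: "0 < \<gamma> * \<theta>" using \<theta> \<gamma> by simp
  show "(1 + \<theta>) * (1 + \<gamma>) \<le> 2 * \<theta>" "\<gamma> * (1 + 2 * \<theta>) \<le> \<theta>" and \<theta>1: "1 \<le> \<theta>"
    using param3 \<gamma>\<theta> \<gamma> by (auto simp: algebra_simps)
  \<comment> \<open>Since \<open>2 * \<gamma> \<le> (1 + \<gamma>)\<^sup>2\<close>, the first
    parameter condition gives \<open>8 * \<nu> * \<theta> \<le> 1\<close>.\<close>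
  have "4 * \<nu> * \<theta> * (2 * \<gamma>) \<le> 4 * \<nu> * \<theta> * (1 + \<gamma>)\<^sup>2"
    using \<nu> \<theta> by (intro mult_left_mono) (auto simp: power2_eq_square algebra_simps)
  then have "8 * (\<nu> * \<theta>) * \<gamma> \<le> 1 * \<gamma>" unfolding param1 by (simp add: mult_ac)
  then have "8 * (\<nu> * \<theta>) \<le> 1" using \<gamma> mult_le_cancel_right_pos by blast
  moreover have "\<nu> * 1 \<le> \<nu> * \<theta>" using \<nu> \<theta>1 by (intro mult_left_mono) auto
  ultimately show "\<nu> \<le> 1" using \<nu> by linarith
qed

definition "V k = (norm (x (Suc k) - xs))\<^sup>2 + \<theta> * (norm (x (Suc k) - x k))\<^sup>2
  + 2 * h k * \<Phi> (Suc k) + W k * breg (xb (Suc k)) (xt k)"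

lemma norm_x_Suc:
  "(norm (x (Suc k) - xs))\<^sup>2 = (norm (x k - xs))\<^sup>2 + (norm (x (Suc k) - x k))\<^sup>2
    - 2 * \<theta> * inner (x (Suc k) - x k) (x k - x (k - 1)) - 2 * (\<eta> k * inner (g (xt k)) (xh k - xs))"
proof -
  define a where "a = x (Suc k) - x k"
  define p where "p = x k - x (k - 1)"
  define b where "b = x k - xs"
  have a: "\<eta> k *\<^sub>R g (xt k) = - a" by (simp add: a_def step(2))
  have "x (Suc k) - xs = a + b" by (simp add: a_def b_def)
  then have "(norm (x (Suc k) - xs))\<^sup>2 = (norm b)\<^sup>2 + (norm a)\<^sup>2 + 2 * inner a b"
    by (simp add: power2_norm_eq_inner inner_add_left inner_add_right inner_commute)
  also have "\<eta> k * inner (g (xt k)) (xh k - xs) = - inner a (\<theta> *\<^sub>R p + b)"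
  proof -
    have "xh k - xs = \<theta> *\<^sub>R p + b" by (simp add: xh_def p_def b_def)
    then show ?thesis using a by (metis inner_minus_left inner_scaleR_left)
  qed
  then have "2 * inner a b = - 2 * \<theta> * inner a p - 2 * (\<eta> k * inner (g (xt k)) (xh k - xs))"
    by (simp add: inner_add_right)
  finally show ?thesis by (simp add: a_def b_def p_def)
qed

lemma bregman_self [simp]: "breg z z = 0"
  by (simp add: bregman_def)

text \<open>Combining \<open>norm_x_Suc\<close> with \<open>linear_lower\<close> leaves a cross
  term, which \<open>extrapolated_step_bound\<close> reduces to the gradient change. By
  \<open>grad_change\<close> this costs at most \<open>m * (Bn + Bo)\<close>, which the weights
  \<open>W n\<close> and \<open>W k\<close> absorb.\<close>

lemma V_Suc: "V (Suc k) \<le> V k"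
proof -
  define n where "n = Suc k"
  define a where "a = x (Suc n) - x n"
  define p where "p = x n - x k"
  define \<delta> where "\<delta> = \<eta> n *\<^sub>R (g (xt n) - g (xt k))"
  define Bn where "Bn = breg (xb n) (xt n)"
  define Bo where "Bo = breg (xb n) (xt k)"
  define m where "m = \<eta> n * (h (k - 1) / \<eta> (k - 1)) / (1 + \<gamma>)\<^sup>2"
  have Bpos: "0 \<le> Bn" "0 \<le> Bo" by (simp_all add: Bn_def Bo_def breg_nonneg)
  have g1: "0 < 1 + \<gamma>" using \<gamma> by simp
  have "a = (\<eta> n / \<eta> k) *\<^sub>R p - \<delta>"
    by (simp add: a_def p_def \<delta>_def n_def step(2) algebra_simps)
  then have key: "(1 + \<theta>) * (norm a)\<^sup>2 - 2 * \<theta> * inner a p - \<theta> * (norm p)\<^sup>2 \<le> (1 + 2 * \<theta>) * (norm \<delta>)\<^sup>2"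
    by (rule extrapolated_step_bound [OF _ _ _ \<theta> param_bounds(1)])
      (use \<eta>_Suc_le [of k] \<eta>_h_pos [of k] in \<open>auto simp: n_def field_simps\<close>)
  have n\<delta>: "(norm \<delta>)\<^sup>2 = \<eta> n * (\<eta> n * (norm (g (xt n) - g (xt k)))\<^sup>2)"
    by (simp add: \<delta>_def power_mult_distrib power2_eq_square)
  have "(1 + 2 * \<theta>) * (norm \<delta>)\<^sup>2 \<le> \<theta> / \<gamma> * (norm \<delta>)\<^sup>2"
    using param_bounds(2) \<gamma> by (intro mult_right_mono) (auto simp: field_simps)
  also have "\<dots> \<le> \<theta> / \<gamma> * (\<eta> n * (4 * \<nu> * (h (k - 1) / \<eta> (k - 1)) * (Bn + Bo)))"
    unfolding n\<delta> using grad_change [of k] \<theta> \<gamma>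
    by (intro mult_left_mono) (auto simp: n_def Bn_def Bo_def)
  also have "\<dots> = 4 * \<nu> * \<theta> / \<gamma> * (\<eta> n * (h (k - 1) / \<eta> (k - 1)) * (Bn + Bo))"
    by simp
  \<comment> \<open>The first parameter condition is calibrated for this: one factor
    \<open>1 + \<gamma>\<close> absorbs a stepsize ratio, the other is the one in
    \<open>W\<close>.\<close>
  also have "4 * \<nu> * \<theta> / \<gamma> = 1 / (1 + \<gamma>)\<^sup>2"
    using param1 \<gamma> by (simp add: divide_simps add_pos_pos)
  also have "1 / (1 + \<gamma>)\<^sup>2 * (\<eta> n * (h (k - 1) / \<eta> (k - 1)) * (Bn + Bo)) = m * (Bn + Bo)"
    by (simp add: m_def)
  finally have \<delta>: "(1 + 2 * \<theta>) * (norm \<delta>)\<^sup>2 \<le> m * Bn + m * Bo"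
    by (simp only: distrib_left)
  have prev: "\<eta> k \<le> (1 + \<gamma>) * \<eta> (k - 1)"
  proof (cases k)
    case 0
    then show ?thesis using \<gamma> eta0 by simp
  qed (use \<eta>_Suc_le in simp)
  have "m = \<eta> n * h (k - 1) / ((1 + \<gamma>) * ((1 + \<gamma>) * \<eta> (k - 1)))"
    by (simp add: m_def power2_eq_square mult_ac)
  also have "\<dots> \<le> \<eta> n * h k / ((1 + \<gamma>) * \<eta> k)"
    using prev h_mono [of k] \<eta>_h_pos [of k] g1
    by (intro frac_le mult_left_mono mult_nonneg_nonneg mult_pos_pos) auto
  also have "\<dots> = W n"
    by (simp add: W_def n_def mult.commute)
  finally have "m * Bn \<le> W n * Bn" using Bpos by (intro mult_right_mono)
  \<comment> \<open>At \<open>k = 0\<close> the weight \<open>W 0\<close> vanishes, but so does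
    \<open>Bo\<close>, since \<open>\<beta> 0 = 1\<close> gives \<open>xb 1 = xt 0\<close>.\<close>
  moreover have "m * Bo \<le> W k * Bo"
  proof (cases k)
    case 0
    then show ?thesis by (simp add: Bo_def n_def step(3))
  next
    case (Suc j)
    have "m = \<eta> n * h j / ((1 + \<gamma>) * ((1 + \<gamma>) * \<eta> j))"
      by (simp add: m_def Suc power2_eq_square mult_ac)
    also have "\<dots> \<le> ((1 + \<gamma>) * \<eta> k) * h j / ((1 + \<gamma>) * ((1 + \<gamma>) * \<eta> j))"
      using \<eta>_Suc_le [of k] g1 by (intro divide_right_mono mult_right_mono) (auto simp: n_def)
    also have "\<dots> = W k"
      using g1 by (simp add: W_def Suc mult_ac)
    finally show ?thesis using Bpos by (intro mult_right_mono)
  qed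
  moreover have "(norm (x (Suc n) - xs))\<^sup>2 = (norm (x n - xs))\<^sup>2 + (norm a)\<^sup>2
      - 2 * \<theta> * inner a p - 2 * (\<eta> n * inner (g (xt n)) (xh n - xs))"
    using norm_x_Suc [of n] by (simp add: a_def p_def n_def)
  moreover have "h n * \<Phi> (Suc n) - h k * \<Phi> n + W n * Bn \<le> \<eta> n * inner (g (xt n)) (xh n - xs)"
    using linear_lower [of n] by (simp add: Bn_def n_def)
  moreover have "W n * breg (xb (Suc n)) (xt n) \<le> W n * Bn"
    using breg_xb_Suc W_nonneg by (simp add: Bn_def mult_left_mono)
  ultimately have "(norm (x (Suc n) - xs))\<^sup>2 + \<theta> * (norm a)\<^sup>2 + 2 * h n * \<Phi> (Suc n)
      + W n * breg (xb (Suc n)) (xt n)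
    \<le> (norm (x n - xs))\<^sup>2 + \<theta> * (norm p)\<^sup>2 + 2 * h k * \<Phi> n + W k * Bo"
    using key \<delta> by (simp add: algebra_simps)
  then show ?thesis by (simp add: V_def n_def a_def p_def Bo_def)
qed

section \<open>Boundedness of the iterates\<close>

abbreviation "R \<equiv> norm (x0 - xs)"
text \<open>The factor in \<open>V_0\<close>: 1 from the initial distance and
  \<open>1 + \<theta>\<close> from the first displacement, whose length is at most
  \<open>R\<close>.\<close>

definition "M = 2 + \<theta>"

lemma M_ge: "2 \<le> M" "1 \<le> M" "0 < M" "0 \<le> M"
  using \<theta> by (simp_all add: M_def)

text \<open>The gradient vanishes at \<open>xs\<close>, and the condition on \<open>eta0\<close>
  cancels the local Lipschitz constant.\<close>

lemma initial_gradient: "eta0 * norm (g x0) \<le> R"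
proof -
  have "norm (g x0) \<le> exp (L1 * R) * L0 * R"
    using grad_lipschitz_near [of xs x0] x0 by (simp add: grad_xs)
  then have "eta0 * norm (g x0) \<le> eta0 * (exp (L1 * R) * L0 * R)"
    using eta0 by (intro mult_left_mono) auto
  also have "\<dots> = (eta0 * L0 * exp (L1 * R)) * R" by simp
  also have "\<dots> \<le> 1 * R" using eta0 by (intro mult_right_mono) auto
  finally show ?thesis by simp
qed

lemma V_0: "V 0 \<le> M * R\<^sup>2"
proof -
  have [simp]: "xh 0 = x0" by (simp add: xh_def)
  have "norm (x (Suc 0) - x0) = eta0 * norm (g x0)"
    using eta0 by (simp add: step(2))
  then have "(norm (x (Suc 0) - x0))\<^sup>2 \<le> R\<^sup>2"
    using initial_gradient eta0 by (intro power_mono) auto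
  then have "(1 + \<theta>) * (norm (x (Suc 0) - x0))\<^sup>2 \<le> (1 + \<theta>) * R\<^sup>2"
    using \<theta> by (intro mult_left_mono) auto
  moreover have "eta0 * \<Phi> (Suc 0) \<le> eta0 * inner (g x0) (x0 - xs)"
    using linear_lower [of 0] by (simp add: W_def)
  ultimately show ?thesis
    using norm_x_Suc [of 0] by (simp add: V_def W_def M_def algebra_simps)
qed

lemma V_le: "V k \<le> M * R\<^sup>2"
proof (induction k)
  case (Suc k)
  then show ?case using V_Suc [of k] by linarith
qed (rule V_0)

lemma V_parts:
  "(norm (x (Suc k) - xs))\<^sup>2 \<le> M * R\<^sup>2" "\<theta> * (norm (x (Suc k) - x k))\<^sup>2 \<le> M * R\<^sup>2"
  "2 * h k * \<Phi> (Suc k) \<le> M * R\<^sup>2"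
proof -
  have "0 \<le> (norm (x (Suc k) - xs))\<^sup>2" "0 \<le> \<theta> * (norm (x (Suc k) - x k))\<^sup>2"
    "0 \<le> 2 * h k * \<Phi> (Suc k)" "0 \<le> W k * breg (xb (Suc k)) (xt k)"
    using \<theta> \<Phi>_nonneg W_nonneg breg_nonneg by simp_all
  then show "(norm (x (Suc k) - xs))\<^sup>2 \<le> M * R\<^sup>2" "\<theta> * (norm (x (Suc k) - x k))\<^sup>2 \<le> M * R\<^sup>2"
    "2 * h k * \<Phi> (Suc k) \<le> M * R\<^sup>2"
    using V_le [of k] unfolding V_def by linarith+
qed

text \<open>The distance of \<open>x k\<close> from \<open>xs\<close> and the extrapolation term are
  each at most \<open>M * R\<close>, by the first two parts of \<open>V\<close>.\<close>

lemma xh_near: "norm (xh k - xs) \<le> 2 * M * R"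
proof (cases k)
  case 0
  have "1 * R \<le> 2 * M * R" using M_ge by (intro mult_right_mono) auto
  then show ?thesis by (simp add: 0 xh_def)
next
  case (Suc j)
  have M1: "M \<le> M\<^sup>2" "\<theta> * M \<le> M\<^sup>2" using \<theta> by (auto simp: M_def power2_eq_square algebra_simps)
  have "(norm (x (Suc j) - xs))\<^sup>2 \<le> M * R\<^sup>2" by (rule V_parts)
  also have "\<dots> \<le> M\<^sup>2 * R\<^sup>2" using M1 by (intro mult_right_mono) auto
  finally have "(norm (x (Suc j) - xs))\<^sup>2 \<le> M\<^sup>2 * R\<^sup>2" .
  then have "(norm (x k - xs))\<^sup>2 \<le> (M * R)\<^sup>2" by (simp add: Suc power_mult_distrib)
  then have 1: "norm (x k - xs) \<le> M * R" by (rule power2_le_imp_le) (use M_ge in simp)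
  have "(\<theta> * norm (x (Suc j) - x j))\<^sup>2 = \<theta> * (\<theta> * (norm (x (Suc j) - x j))\<^sup>2)"
    by (simp add: power2_eq_square)
  also have "\<dots> \<le> \<theta> * (M * R\<^sup>2)" using V_parts(2) \<theta> by (intro mult_left_mono) auto
  also have "\<dots> \<le> M\<^sup>2 * R\<^sup>2" using M1 by (simp add: mult_right_mono flip: mult.assoc)
  finally have "(\<theta> * norm (x (Suc j) - x j))\<^sup>2 \<le> M\<^sup>2 * R\<^sup>2" .
  then have "(\<theta> * norm (x k - x (k - 1)))\<^sup>2 \<le> (M * R)\<^sup>2" by (simp add: Suc power_mult_distrib)
  then have 2: "\<theta> * norm (x k - x (k - 1)) \<le> M * R" by (rule power2_le_imp_le) (use M_ge in simp)
  have eq: "xh k - xs = (x k - xs) + \<theta> *\<^sub>R (x k - x (k - 1))" by (simp add: xh_def)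
  have "norm (xh k - xs) \<le> norm (x k - xs) + \<theta> * norm (x k - x (k - 1))"
    unfolding eq using norm_triangle_ineq [of "x k - xs" "\<theta> *\<^sub>R (x k - x (k - 1))"] \<theta> by simp
  with 1 2 show ?thesis by simp
qed

text \<open>The averages \<open>xb\<close> inherit the bound on \<open>xh\<close> through
  \<open>xb_Suc_eq\<close>.\<close>

lemma xb_near: "norm (xb k - xs) \<le> 2 * M * R"
proof (induction k)
  case 0
  have "1 * R \<le> 2 * M * R" using M_ge by (intro mult_right_mono) auto
  then show ?case by simp
next
  case (Suc k)
  have hk: "h k = \<eta> k + h' k" by (simp add: h'_def)
  have "h k *\<^sub>R (xb (Suc k) - xs) = \<eta> k *\<^sub>R (xh k - xs) + h' k *\<^sub>R (xb k - xs)"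
    unfolding scaleR_diff_right xb_Suc_eq by (simp add: hk algebra_simps)
  then have "norm (h k *\<^sub>R (xb (Suc k) - xs)) \<le> norm (\<eta> k *\<^sub>R (xh k - xs)) + norm (h' k *\<^sub>R (xb k - xs))"
    by (simp only: norm_triangle_ineq)
  also have "\<dots> = \<eta> k * norm (xh k - xs) + h' k * norm (xb k - xs)"
    using h'_nonneg by simp
  also have "\<dots> \<le> \<eta> k * (2 * M * R) + h' k * (2 * M * R)"
    using xh_near Suc h'_nonneg by (intro add_mono mult_left_mono) auto
  also have "\<dots> = h k * (2 * M * R)" by (simp add: hk distrib_right)
  finally show ?case using \<eta>_h_pos [of k] by simp
qed

lemma xh_xb_near: "norm (xh k - xb k) \<le> 4 * M * R"
  using norm_triangle_ineq4 [of "xh k - xs" "xb k - xs"] xh_near [of k] xb_near [of k] by simp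

section \<open>Lower bounds for the stepsizes\<close>

abbreviation "u k \<equiv> \<eta> k / h k"

lemma u_pos: "0 < u k"
  using \<eta>_h_pos by simp

lemma xt_xb_near: "norm (xt (Suc k) - xb (Suc k)) \<le> 4 * (1 + \<gamma>) * M * R * u k"
proof -
  have "xt (Suc k) - xb (Suc k) = \<alpha> (Suc k) *\<^sub>R (xh (Suc k) - xb (Suc k))"
    by (simp add: step(4) algebra_simps)
  then have "norm (xt (Suc k) - xb (Suc k)) = \<alpha> (Suc k) * norm (xh (Suc k) - xb (Suc k))"
    using \<alpha>_bounds(1) [of "Suc k"] by simp
  also have "\<dots> \<le> (1 + \<gamma>) * u k * (4 * M * R)"
  proof (intro mult_mono xh_xb_near)
    show "\<alpha> (Suc k) \<le> (1 + \<gamma>) * u k"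
      unfolding step(1) times_divide_eq_right
      using \<eta>_h_pos [of k] \<gamma> by (intro divide_left_mono) (auto intro!: add_pos_pos mult_pos_pos)
  qed (use u_pos [of k] \<gamma> in auto)
  finally show ?thesis by (simp only: mult_ac)
qed

text \<open>For \<open>xt (Suc k)\<close> this is \<open>xt_xb_near\<close>. Moving from
  \<open>xb k\<close> to \<open>xb (Suc k)\<close> only approaches \<open>xt k\<close>, so the
  previous bound serves for \<open>xt k\<close>; at \<open>k = 0\<close> the two points
  coincide.\<close>

lemma tilde_distance:
  assumes "z \<in> {xt k, xt (Suc k)}"
  shows "norm (z - xb (Suc k)) \<le> 4 * (1 + \<gamma>) * M * R * max (u k) (u (k - 1))"
proof -
  have c: "0 \<le> 4 * (1 + \<gamma>) * M * R" using \<gamma> M_ge by simp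
  have mono: "4 * (1 + \<gamma>) * M * R * u j \<le> 4 * (1 + \<gamma>) * M * R * max (u k) (u (k - 1))"
    if "j \<in> {k, k - 1}" for j
    using that by (intro mult_left_mono c) auto
  have "norm (xt (Suc k) - xb (Suc k)) \<le> 4 * (1 + \<gamma>) * M * R * u k"
    by (rule xt_xb_near)
  moreover have "norm (xt k - xb (Suc k)) \<le> 4 * (1 + \<gamma>) * M * R * u (k - 1)"
  proof (cases k)
    case 0
    then show ?thesis using c u_pos [of 0] by (simp add: step(3))
  next
    case (Suc j)
    have "xt k - xb (Suc k) = (1 - \<beta> k) *\<^sub>R (xt k - xb k)"
      by (simp add: step(3) algebra_simps)
    then have "norm (xt k - xb (Suc k)) = (1 - \<beta> k) * norm (xt k - xb k)"
      using \<beta>_bounds [of k] by simp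
    also have "\<dots> \<le> norm (xt k - xb k)"
      using \<beta>_bounds [of k] by (intro mult_left_le_one_le) auto
    also have "\<dots> \<le> 4 * (1 + \<gamma>) * M * R * u (k - 1)"
      using xt_xb_near [of j] by (simp add: Suc)
    finally show ?thesis .
  qed
  ultimately show ?thesis using mono [of k] mono [of "k - 1"] assms by auto
qed

text \<open>\<open>breg_lower\<close> against \<open>xs\<close> is a quadratic inequality for the
  scaled gradient norm \<open>G\<close>, which yields \<open>G \<le> L0 + P\<close>; the decay of
  the gap bounds \<open>P\<close>.\<close>

lemma ell_xb: "ell (xb (Suc k)) \<le> exp 1 * M * (L0 + (L1 * R)\<^sup>2 / h k)"
proof -
  define G where "G = L1 * norm (g (xb (Suc k)))"
  define P where "P = 2 * exp 1 * L1\<^sup>2 * \<Phi> (Suc k)"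
  have P0: "0 \<le> P" using \<Phi>_nonneg by (simp add: P_def)
  have G0: "0 \<le> G" using L1 by (simp add: G_def)
  have "breg (xb (Suc k)) xs = \<Phi> (Suc k)"
    by (simp add: bregman_def grad_xs \<Phi>_def)
  then have "(norm (g (xb (Suc k))))\<^sup>2 \<le> 2 * (exp 1 * (L0 + G)) * \<Phi> (Suc k)"
    using breg_lower [of "xb (Suc k)" xs] by (simp add: grad_xs G_def)
  then have "L1\<^sup>2 * (norm (g (xb (Suc k))))\<^sup>2 \<le> L1\<^sup>2 * (2 * (exp 1 * (L0 + G)) * \<Phi> (Suc k))"
    by (intro mult_left_mono) auto
  then have le: "G * G \<le> P * (L0 + G)"
    by (simp add: G_def P_def power2_eq_square algebra_simps)
  have "G \<le> L0 + P"
  proof (rule ccontr)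
    assume "\<not> G \<le> L0 + P"
    then have "L0 + P < G" by simp
    then have "(L0 + P) * G < G * G" "L0 * P \<le> L0 * G" using L0 P0 by auto
    with le show False by (simp add: algebra_simps)
  qed
  moreover have "P \<le> exp 1 * M * ((L1 * R)\<^sup>2 / h k)"
  proof -
    have "2 * \<Phi> (Suc k) \<le> M * R\<^sup>2 / h k"
      using V_parts(3) [of k] \<eta>_h_pos [of k] by (simp add: field_simps)
    then have "(exp 1 * L1\<^sup>2) * (2 * \<Phi> (Suc k)) \<le> (exp 1 * L1\<^sup>2) * (M * R\<^sup>2 / h k)"
      by (intro mult_left_mono) auto
    then show ?thesis by (simp add: P_def power_mult_distrib mult_ac)
  qed
  moreover have "2 * L0 \<le> exp 1 * M * L0"
  proof -
    have "1 * 2 \<le> exp 1 * M" using M_ge by (intro mult_mono) auto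
    then show ?thesis using L0 by simp
  qed
  ultimately show ?thesis by (simp add: G_def distrib_left)
qed

text \<open>One factor \<open>exp 1\<close> stems from \<open>curv_lower\<close>, the other and
  \<open>M\<close> from \<open>ell_xb\<close>; the 2 adds two equal bounds in
  \<open>lam_lower\<close>.\<close>

definition "c0 = \<nu> / (2 * (exp 1)\<^sup>2 * M)"
definition "r0 = 4 * (1 + \<gamma>) * M"

text \<open>By \<open>ell_growth\<close> the gradients at the two points \<open>xt\<close> exceed
  \<open>ell (xb (Suc k))\<close> at most by an exponential in their distance, which is proportional
  to the recent ratios \<open>u\<close>.\<close>

lemma stepsize_lower:
  "\<eta> (Suc k) = (1 + \<gamma>) * \<eta> k \<or>
   c0 * exp (- r0 * (L1 * R) * max (u k) (u (k - 1))) * (h (k - 1) / \<eta> (k - 1)) /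
     (L0 + (L1 * R)\<^sup>2 / h k) \<le> \<eta> (Suc k)"
proof -
  define m where "m = r0 * (L1 * R) * max (u k) (u (k - 1))"
  define B where "B = L0 + (L1 * R)\<^sup>2 / h k"
  define e where "e = exp m * ell (xb (Suc k))"
  have B: "0 < B" using L0 by (simp add: B_def add_pos_nonneg)
  have M0: "0 < M" by (rule M_ge)
  have m0: "0 \<le> m" using u_pos [of k] L1 \<gamma> M_ge by (simp add: m_def r0_def le_max_iff_disj less_imp_le)
  have "L1 * norm (g z) \<le> exp m * ell (xb (Suc k))" if z: "z \<in> {xt k, xt (Suc k)}" for z
  proof -
    have "L1 * norm (z - xb (Suc k)) \<le> L1 * (4 * (1 + \<gamma>) * M * R * max (u k) (u (k - 1)))"
      using tilde_distance [OF z] L1 by (intro mult_left_mono) auto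
    then have m: "L1 * norm (z - xb (Suc k)) \<le> m" by (simp add: m_def r0_def mult_ac)
    have "L1 * norm (g z) \<le> ell z" using L0 by simp
    also have "\<dots> \<le> exp (L1 * norm (z - xb (Suc k))) * ell (xb (Suc k))"
      using z by (intro ell_growth) auto
    also have "\<dots> \<le> exp m * ell (xb (Suc k))"
      using m by (intro mult_right_mono) auto
    finally show ?thesis .
  qed
  then have "L1 * max (norm (g (xt k))) (norm (g (xt (Suc k)))) \<le> e"
    by (auto simp: e_def max_def)
  moreover have "ell (xb (Suc k)) \<le> e"
    using m0 by (auto simp: e_def intro!: mult_right_mono [of 1, simplified])
  moreover have "e \<le> exp m * (exp 1 * M * B)"
    unfolding B_def e_def using ell_xb by (intro mult_left_mono) auto
  ultimately have D: "ell (xb (Suc k)) + L1 * max (norm (g (xt k))) (norm (g (xt (Suc k))))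
      \<le> 2 * (exp m * (exp 1 * M * B))" (is "?D \<le> _")
    by linarith
  have D0: "0 < ?D" using L0 L1 by (intro add_pos_nonneg) (auto simp: le_max_iff_disj)
  show ?thesis
  proof (rule lam_cases [of k])
    fix l assume l: "0 < l" "lam k = ereal l"
      "\<eta> (Suc k) = min ((1 + \<gamma>) * \<eta> k) (\<nu> * h (k - 1) * l / \<eta> (k - 1))"
    have "1 / (exp 1 * (2 * (exp m * (exp 1 * M * B)))) \<le> 1 / (exp 1 * ?D)"
      using D D0 M0 B by (intro divide_left_mono mult_left_mono mult_pos_pos) auto
    also have "\<dots> \<le> l" using lam_lower [of k] by (simp add: l(2))
    finally have "\<nu> * (h (k - 1) / \<eta> (k - 1)) * (1 / (exp 1 * (2 * (exp m * (exp 1 * M * B)))))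
        \<le> \<nu> * (h (k - 1) / \<eta> (k - 1)) * l"
      using \<nu> by (intro mult_left_mono) auto
    moreover have "\<nu> * (h (k - 1) / \<eta> (k - 1)) * (1 / (exp 1 * (2 * (exp m * (exp 1 * M * B)))))
        = c0 * exp (- m) * (h (k - 1) / \<eta> (k - 1)) / B"
      by (simp add: c0_def exp_minus power2_eq_square divide_simps)
    ultimately show ?thesis using l(3) by (auto simp: m_def B_def min_def)
  qed simp
qed

section \<open>Application of the growth recursion and the iteration count\<close>

sublocale growth "\<lambda>k. L0 * h k" "\<lambda>k. L0 * \<eta> k" "L1 * R" \<gamma> c0 r0
proof
  have M: "1 \<le> 2 * (exp 1)\<^sup>2 * M"
  proof -
    have "1 * 1 \<le> (exp 1)\<^sup>2 * M" using M_ge by (intro mult_mono one_le_power) auto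
    then show ?thesis by simp
  qed
  show "0 < c0" using \<nu> M_ge by (simp add: c0_def)
  show "c0 \<le> 1" using \<nu> param_bounds(4) M M_ge by (simp add: c0_def divide_le_eq)
  show "0 \<le> L1 * R" "0 \<le> r0" using L1 \<gamma> M_ge by (simp_all add: r0_def)
  \<comment> \<open>As the exponential is at least 1, the condition on \<open>eta0\<close> gives
    \<open>L0 * h 0 \<le> 1\<close>.\<close>
  have "eta0 * L0 * 1 \<le> eta0 * L0 * exp (L1 * R)"
    using eta0 L0 L1 by (intro mult_left_mono) auto
  with eta0 show "L0 * h 0 \<le> 1" by (simp add: mult.commute)
  fix k
  show "0 < L0 * \<eta> k" using L0 \<eta>_h_pos by simp
  show "L0 * h (Suc k) = L0 * h k + L0 * \<eta> (Suc k)" by (simp add: step(6) distrib_left)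
  show "L0 * \<eta> (Suc k) \<le> (1 + \<gamma>) * (L0 * \<eta> k)" using \<eta>_Suc_le [of k] L0 by simp
  have "c0 * exp (- r0 * (L1 * R) * max (u k) (u (k - 1))) * (h (k - 1) / \<eta> (k - 1)) *
     (L0 * h k / (L0 * h k + (L1 * R)\<^sup>2)) \<le> L0 * \<eta> (Suc k)"
    if "c0 * exp (- r0 * (L1 * R) * max (u k) (u (k - 1))) * (h (k - 1) / \<eta> (k - 1)) /
     (L0 + (L1 * R)\<^sup>2 / h k) \<le> \<eta> (Suc k)" (is "?Z / _ \<le> _")
  proof -
    have "L0 * h k / (L0 * h k + (L1 * R)\<^sup>2) = L0 / (L0 + (L1 * R)\<^sup>2 / h k)"
      by (simp add: divide_simps)
    then have "?Z * (L0 * h k / (L0 * h k + (L1 * R)\<^sup>2)) = L0 * (?Z / (L0 + (L1 * R)\<^sup>2 / h k))"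
      by simp
    also have "\<dots> \<le> L0 * \<eta> (Suc k)" using that L0 by (intro mult_left_mono) auto
    finally show ?thesis .
  qed
  with stepsize_lower [of k]
  show "L0 * \<eta> (Suc k) = (1 + \<gamma>) * (L0 * \<eta> k) \<or>
      c0 * exp (- r0 * (L1 * R) * max (L0 * \<eta> k / (L0 * h k)) (L0 * \<eta> (k - 1) / (L0 * h (k - 1)))) *
      (L0 * h (k - 1) / (L0 * \<eta> (k - 1))) * (L0 * h k / (L0 * h k + (L1 * R)\<^sup>2)) \<le> L0 * \<eta> (Suc k)"
    using L0 by auto
qed (use \<gamma> in simp_all)

text \<open>A gap above \<epsilon> after \<open>Suc n\<close> iterations keeps \<open>h n\<close> of
  order \<open>R\<^sup>2 / \<epsilon>\<close>, and \<open>step_count\<close> then bounds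
  \<open>n\<close>.\<close>

lemma iteration_bound:
  assumes \<epsilon>: "0 < \<epsilon>" "\<epsilon> < \<Phi> (Suc n)" and D: "R \<le> D"
  shows "min 1 (ln (1 + \<gamma>)) * real n \<le> 30 * \<kappa> * M *
    (1 + sqrt (L0 * D\<^sup>2 / \<epsilon>) + L1 ^ 3 * D ^ 3 + (1 + L1\<^sup>2 * D\<^sup>2) * ln (1 / (eta0 * L0)))"
proof -
  define q where "q = L1 * R"
  define A where "A = L0 * h n"
  define s where "s = sqrt (L0 * D\<^sup>2 / \<epsilon>)"
  define l where "l = ln (1 / (eta0 * L0))"
  have q0: "0 \<le> q" using L1 by (simp add: q_def)
  have qD: "q \<le> L1 * D" using L1 D by (simp add: q_def)
  have A: "0 < A" unfolding A_def by (rule A_pos)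
  have Q: "1 \<le> Q" "Q = 1 + q\<^sup>2" by (simp_all add: Q_ge Q_def q_def)
  have e0: "0 < eta0 * L0" using eta0 L0 by simp
  have l0: "0 \<le> l" using A_0(2) e0 by (simp add: l_def ln_div mult.commute)
  have M: "1 \<le> M" by (rule M_ge)
  have \<kappa>0: "0 \<le> \<kappa>" using r c'(1) by (simp add: \<kappa>_def)
  have "A \<le> M * (L0 * D\<^sup>2 / \<epsilon>)"
  proof -
    have "h n * \<epsilon> \<le> h n * \<Phi> (Suc n)" using \<epsilon> by (intro mult_left_mono) auto
    also have "\<dots> \<le> 2 * h n * \<Phi> (Suc n)" using \<Phi>_nonneg by simp
    also have "\<dots> \<le> M * R\<^sup>2" by (rule V_parts)
    also have "\<dots> \<le> M * D\<^sup>2" using D M by (intro mult_left_mono power_mono) auto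
    finally have "L0 * (h n * \<epsilon>) \<le> L0 * (M * D\<^sup>2)" using L0 by (intro mult_left_mono) auto
    then show ?thesis using \<epsilon> by (simp add: A_def field_simps)
  qed
  also have "\<dots> \<le> M\<^sup>2 * (L0 * D\<^sup>2 / \<epsilon>)"
    using M L0 \<epsilon> by (intro mult_right_mono) (auto simp: power2_eq_square)
  finally have "sqrt A \<le> sqrt (M\<^sup>2 * (L0 * D\<^sup>2 / \<epsilon>))" by (rule real_sqrt_le_mono)
  also have "\<dots> = M * s" using M unfolding s_def real_sqrt_mult [of "M\<^sup>2"] by simp
  finally have sA: "sqrt A \<le> M * s" .
  have "ln Q \<le> 2 * q"
  proof -
    have "Q \<le> (1 + q)\<^sup>2" using q0 by (simp add: Q power2_sum)
    then have "ln Q \<le> ln ((1 + q)\<^sup>2)" using Q(1) by (intro ln_mono) linarith+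
    also have "\<dots> = 2 * ln (1 + q)" using q0 by (simp add: ln_realpow)
    also have "\<dots> \<le> 2 * q" using q0 ln_add_one_self_le_self by simp
    finally show ?thesis .
  qed
  \<comment> \<open>Comparing \<open>sqrt A\<close> with \<open>Q\<close> makes
    \<open>Q * ln A\<close> cost only a multiple of \<open>sqrt A\<close> and powers of
    \<open>q\<close>, without a product of root and logarithm.\<close>
  moreover have "ln A \<le> 2 * ln Q + 2 * (sqrt A / Q)"
  proof -
    have "ln (sqrt A / Q) \<le> sqrt A / Q - 1" using A Q(1) by (intro ln_le_minus_one) simp
    moreover have "ln (sqrt A / Q) = ln A / 2 - ln Q" using A Q(1) by (simp add: ln_divide_pos ln_sqrt)
    ultimately show ?thesis by simp
  qed
  ultimately have "ln A \<le> 4 * q + 2 * (sqrt A / Q)" by linarith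
  then have "Q * ln A \<le> Q * (4 * q + 2 * (sqrt A / Q))" using Q by (intro mult_left_mono) auto
  also have "\<dots> = 4 * (q * Q) + 2 * sqrt A" using Q(1) by (simp add: distrib_left)
  finally have QA: "Q * ln A \<le> 4 * (q * Q) + 2 * sqrt A" .
  \<comment> \<open>The intermediate powers of \<open>q\<close> are absorbed into the constant and
    the cubic term of the claim.\<close>
  have "q \<le> 1 + q ^ 3 \<and> q\<^sup>2 \<le> 1 + q ^ 3"
  proof (cases "q \<le> 1")
    case True
    then show ?thesis using q0 power_le_one [of q 2] by (simp add: add_increasing2)
  next
    case False
    then have "q \<le> q ^ 3" "q\<^sup>2 \<le> q ^ 3"
      using power_increasing [of 1 3 q] power_increasing [of 2 3 q] by auto
    then show ?thesis by (intro conjI) linarith+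
  qed
  moreover have "q * Q = q + q ^ 3" by (simp add: Q power2_eq_square power3_eq_cube distrib_left)
  ultimately have "Q + 4 * (q * Q) \<le> 10 * (1 + q ^ 3)" using q0 by (simp add: Q)
  also have "q ^ 3 \<le> L1 ^ 3 * D ^ 3" using power_mono [OF qD q0, of 3] by (simp add: power_mult_distrib)
  finally have 1: "Q + 4 * (q * Q) \<le> 10 * (1 + L1 ^ 3 * D ^ 3)" by simp
  have 2: "Q * l \<le> (1 + L1\<^sup>2 * D\<^sup>2) * l"
    using power_mono [OF qD q0, of 2] l0 by (intro mult_right_mono) (auto simp: Q power_mult_distrib)
  have ln0: "- ln (L0 * h 0) = l" using eta0(1) L0 by (simp add: l_def ln_div mult.commute)
  define Z where "Z = 1 + s + L1 ^ 3 * D ^ 3 + (1 + L1\<^sup>2 * D\<^sup>2) * l"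
  have "Q + sqrt A + Q * (ln A - ln (L0 * h 0)) = Q + sqrt A + Q * ln A + Q * l"
    by (simp add: algebra_simps flip: ln0)
  also have "\<dots> \<le> 10 * (1 + L1 ^ 3 * D ^ 3) + 3 * (M * s) + (1 + L1\<^sup>2 * D\<^sup>2) * l"
    using QA sA 1 2 by linarith
  also have "\<dots> \<le> 10 * M * (1 + L1 ^ 3 * D ^ 3) + 10 * M * s + 10 * M * ((1 + L1\<^sup>2 * D\<^sup>2) * l)"
  proof (intro add_mono)
    have D0: "0 \<le> D" using D norm_ge_zero order_trans by blast
    show "10 * (1 + L1 ^ 3 * D ^ 3) \<le> 10 * M * (1 + L1 ^ 3 * D ^ 3)"
      using M L1 D0 by (intro mult_right_mono) auto
    have "0 \<le> s" using L0 \<epsilon> by (simp add: s_def)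
    then show "3 * (M * s) \<le> 10 * M * s" using M by simp
    have "0 \<le> (1 + L1\<^sup>2 * D\<^sup>2) * l" using l0 by simp
    then have "1 * ((1 + L1\<^sup>2 * D\<^sup>2) * l) \<le> 10 * M * ((1 + L1\<^sup>2 * D\<^sup>2) * l)"
      using M by (intro mult_right_mono) auto
    then show "(1 + L1\<^sup>2 * D\<^sup>2) * l \<le> 10 * M * ((1 + L1\<^sup>2 * D\<^sup>2) * l)" by simp
  qed
  also have "\<dots> = 10 * M * Z" by (simp add: Z_def algebra_simps)
  finally have "3 * \<kappa> * (Q + sqrt A + Q * (ln A - ln (L0 * h 0))) \<le> 3 * \<kappa> * (10 * M * Z)"
    using \<kappa>0 by (intro mult_left_mono) auto
  with step_count [of n] have "min 1 (ln (1 + \<gamma>)) * real n \<le> 3 * \<kappa> * (10 * M * Z)"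
    unfolding A_def by (rule order_trans)
  also have "\<dots> = 30 * \<kappa> * M * Z" by simp
  finally show ?thesis by (simp only: Z_def s_def l_def)
qed

end

section \<open>Choice of the uniform constant and the final estimate\<close>

theorem corollary3:
  fixes \<theta> \<gamma> \<nu> :: real
  assumes "\<theta> > 0" and "\<gamma> > 0" and "\<nu> > 0"
    and "4 * \<nu> * \<theta> * (1 + \<gamma>)\<^sup>2 = \<gamma>"
    and "1 + 2 * \<gamma> + 2 * \<gamma> * \<theta>\<^sup>2 / (1 + \<theta>)\<^sup>2 \<le> \<theta> / (1 + \<theta>) + \<theta>\<^sup>2 / (1 + \<theta>)\<^sup>2"
  shows "\<exists>C>0. \<forall>(d::nat) (f :: fseq \<Rightarrow> real) (L0::real) (L1::real)
      (xstar::fseq) (x0::fseq) (\<epsilon>::real) (eta0::real) (D::real).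
      convex_on (Rd d) f \<longrightarrow> L0 > 0 \<longrightarrow> L1 > 0 \<longrightarrow> L0L1_smooth d L0 L1 f \<longrightarrow>
      minimizer d f xstar \<longrightarrow> x0 \<in> Rd d \<longrightarrow> \<epsilon> > 0 \<longrightarrow>
      eta0 > 0 \<longrightarrow> eta0 * L0 * exp (L1 * norm (x0 - xstar)) \<le> 1 \<longrightarrow>
      D \<ge> 0 \<longrightarrow>
      D\<^sup>2 = Max {1 / (\<gamma> * \<theta>), 2 * (1 + \<gamma>), (1 + 2 * \<theta>)\<^sup>2} *
            ((norm (x0 - xstar))\<^sup>2 + (1 + \<gamma> * \<theta>) * eta0\<^sup>2 * (norm (grad d f x0))\<^sup>2) \<longrightarrow>
      D \<le> C * norm (x0 - xstar) \<and>
      (\<forall>K::nat. K \<ge> 1 \<longrightarrow>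
         real K \<ge> C * (1 + sqrt (L0 * D\<^sup>2 / \<epsilon>) + L1 ^ 3 * D ^ 3 +
                       (1 + L1\<^sup>2 * D\<^sup>2) * ln (1 / (eta0 * L0))) \<longrightarrow>
         f (graal_output d f \<theta> \<gamma> \<nu> x0 eta0 K) - f xstar \<le> \<epsilon>)"
proof -
  \<comment> \<open>The constant must be fixed before \<open>d\<close> and \<open>f\<close>, so the
    values of \<open>M\<close>, \<open>c0\<close> and \<open>\<kappa>\<close> are written out in the
    parameters alone.\<close>
  define M where "M = 2 + \<theta>"
  define m where "m = min 1 (ln (1 + \<gamma>))"
  define c where "c = \<nu> / (2 * (exp 1)\<^sup>2 * M)"
  define k where "k = 2 + 4 * (1 + \<gamma>) * M + 2 / (c / (2 + \<gamma>)\<^sup>2)"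
  define mx where "mx = Max {1 / (\<gamma> * \<theta>), 2 * (1 + \<gamma>), (1 + 2 * \<theta>)\<^sup>2}"
  define C1 where "C1 = 30 * k * M / m"
  define C2 where "C2 = sqrt (mx * (2 + \<gamma> * \<theta>))"
  \<comment> \<open>\<open>C1\<close> covers the iteration bound, \<open>C2\<close> the bound on
    \<open>D\<close>, and 2 the shift from \<open>n\<close> to \<open>K = Suc n\<close>.\<close>
  define C where "C = 2 + C1 + C2"
  have M: "0 < M" using assms by (simp add: M_def)
  have m: "0 < m" using assms by (simp add: m_def)
  have k: "0 < k" using assms M by (simp add: k_def c_def add_pos_pos)
  have C1: "0 \<le> C1" using M m k by (simp add: C1_def)
  have mx: "1 \<le> mx"
  proof -
    have "1 \<le> (1 + 2 * \<theta>)\<^sup>2" using assms by (intro one_le_power) auto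
    also have "\<dots> \<le> mx" unfolding mx_def by (rule Max_ge) auto
    finally show ?thesis .
  qed
  have \<gamma>\<theta>: "0 < \<gamma> * \<theta>" using assms by simp
  have C2: "0 \<le> C2" using mx \<gamma>\<theta> by (simp add: C2_def)
  show ?thesis
  proof (intro exI [of _ C] conjI allI impI)
    show "0 < C" using C1 C2 by (simp add: C_def)
  next
    fix d f L0 L1 xstar x0 and \<epsilon> eta0 D :: real
    assume A: "convex_on (Rd d) f" "L0 > 0" "L1 > 0" "L0L1_smooth d L0 L1 f"
      "minimizer d f xstar" "x0 \<in> Rd d" "\<epsilon> > 0"
      "eta0 > 0" "eta0 * L0 * exp (L1 * norm (x0 - xstar)) \<le> 1" "D \<ge> 0"
      "D\<^sup>2 = Max {1 / (\<gamma> * \<theta>), 2 * (1 + \<gamma>), (1 + 2 * \<theta>)\<^sup>2} *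
        ((norm (x0 - xstar))\<^sup>2 + (1 + \<gamma> * \<theta>) * eta0\<^sup>2 * (norm (grad d f x0))\<^sup>2)"
    interpret G: graal d f L0 L1 \<theta> \<gamma> \<nu> xstar x0 eta0
      using A assms by unfold_locales auto
    let ?R = "norm (x0 - xstar)"
    let ?E = "(1 + \<gamma> * \<theta>) * (eta0 * norm (grad d f x0))\<^sup>2"
    have D2: "D\<^sup>2 = mx * (?R\<^sup>2 + ?E)"
      using A(11) by (simp add: mx_def power_mult_distrib)
    have E0: "0 \<le> ?E" using \<gamma>\<theta> by simp
    \<comment> \<open>\<open>mx \<ge> 1\<close> gives \<open>R \<le> D\<close>, which allows
      \<open>D\<close> to replace \<open>R\<close> in the iteration bound.\<close>
    have "1 * ?R\<^sup>2 \<le> mx * (?R\<^sup>2 + ?E)"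
      using mx E0 by (intro mult_mono) auto
    then have RD: "?R \<le> D"
      using A(10) by (intro power2_le_imp_le [OF _ A(10)]) (simp add: D2)
    have "?E \<le> (1 + \<gamma> * \<theta>) * ?R\<^sup>2"
      using G.initial_gradient A(8) \<gamma>\<theta> by (intro mult_left_mono power_mono) auto
    then have "D\<^sup>2 \<le> mx * (?R\<^sup>2 + (1 + \<gamma> * \<theta>) * ?R\<^sup>2)"
      unfolding D2 using mx by (intro mult_left_mono [OF add_left_mono]) auto
    also have "\<dots> = (C2 * ?R)\<^sup>2"
    proof -
      have "C2\<^sup>2 = mx * (2 + \<gamma> * \<theta>)" using mx \<gamma>\<theta> by (simp add: C2_def)
      then show ?thesis by (simp add: power_mult_distrib algebra_simps)
    qed
    finally have "D \<le> C2 * ?R"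
      using C2 by (intro power2_le_imp_le [of D "C2 * ?R"]) auto
    also have "\<dots> \<le> C * ?R" using C1 by (intro mult_right_mono) (auto simp: C_def)
    finally show "D \<le> C * ?R" .
    fix K :: nat
    let ?Z = "1 + sqrt (L0 * D\<^sup>2 / \<epsilon>) + L1 ^ 3 * D ^ 3 + (1 + L1\<^sup>2 * D\<^sup>2) * ln (1 / (eta0 * L0))"
    assume K: "1 \<le> K" "C * ?Z \<le> real K"
    show "f (graal_output d f \<theta> \<gamma> \<nu> x0 eta0 K) - f xstar \<le> \<epsilon>"
    proof (rule ccontr)
      assume "\<not> ?thesis"
      then have gt: "\<epsilon> < G.\<Phi> K"
        by (simp add: graal_output_def G.\<Phi>_def G.xb_def G.st_def)
      obtain n where n: "K = Suc n" using K(1) by (cases K) auto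
      have "eta0 * L0 \<le> 1" using G.A_0(2) by (simp add: mult.commute)
      then have "0 \<le> ln (1 / (eta0 * L0))" using A(2,8) by (intro ln_ge_zero) simp
      then have "0 \<le> (1 + L1\<^sup>2 * D\<^sup>2) * ln (1 / (eta0 * L0))" by simp
      moreover have "0 \<le> sqrt (L0 * D\<^sup>2 / \<epsilon>)" "0 \<le> L1 ^ 3 * D ^ 3" using A(2,3,7,10) by simp_all
      ultimately have Z: "1 \<le> ?Z" by linarith
      have \<kappa>: "G.\<kappa> = k"
        by (simp only: G.\<kappa>_def G.c'_def) (simp add: G.c0_def G.r0_def G.M_def k_def c_def M_def)
      have "m * real n \<le> 30 * k * M * ?Z"
        using G.iteration_bound [OF A(7) gt [unfolded n] RD] by (simp add: m_def \<kappa> G.M_def M_def)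
      also have "\<dots> = m * (C1 * ?Z)" using m by (simp add: C1_def)
      finally have "real n \<le> C1 * ?Z" using m by simp
      then have "real K < 2 * ?Z + C1 * ?Z" using n Z by simp
      also have "\<dots> \<le> C * ?Z"
        unfolding distrib_right [symmetric] using C2 Z by (intro mult_right_mono) (auto simp: C_def)
      finally show False using K(2) by simp
    qed
  qed
qed

end
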